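(* Let $k$ be an algebraically closed field of characteristic $0$, let $V$ be a $k$-vertex algebra, let $g,h:V\to V$ be automorphisms of finite period $M$ (i.e. $g^M=h^M=\mathrm{id}$), and fix a primitive $M$-th root of unity $\zeta\in k$. Let $\varphi:L(V,g)\to L(V,h)$ be a homomorphism of $k[t^{\pm1}]$-vertex algebras, and let $W$ be a weak $h$-twisted $V$-module with vertex operator map $Y_W(v,z)=\sum_{n\in\frac1M\mathbb Z}v_nz^{-n-1}$. Denote by $\overline\varphi:L(V,g)\to\mathrm{End}(W)$ the linear map obtained by composing $\varphi$ with the linear map $L(V,h)\to\mathrm{End}(W)$, $v_{(n)}\mapsto v_n$. Then the linear map $(\varphi^*Y_W)(\cdot,z):V\to\mathrm{End}(W)[[z^{\frac1M},z^{-\frac1M}]]$ defined by $$(\varphi^*Y_W)(v,z)=\sum_{n\in\frac rM+\mathbb Z}\overline\varphi(v_{(n)})z^{-n-1},\qquad v\in V^{g,r},$$ makes $W$ into a weak $g$-twisted $V$-module.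
   Context: A $k$-vertex algebra is a vertex algebra over $k$ in the usual sense (state-field map $Y(v,z)=\sum_{n\in\mathbb Z}v_nz^{-n-1}$, $v_n \in \mathrm{End}_k(V)$, vacuum $\mathbf 1$, regularity, creation, Jacobi identity; no conformal vector or grading is required). The commutative ring $R=k[t^{\pm1}]$ with derivation $D=\frac d{dt}$ is a commutative vertex algebra via $r_ns=\frac1{(-n-1)!}D^{-n-1}(r)s$ for $n<0$ and $r_ns=0$ for $n\ge0$; likewise $S_M=k[t^{\pm1/M}]$. An $R$-vertex algebra is a vertex ring $U$ (a vertex algebra over $\mathbb Z$) with a homomorphism $\iota:R\to U$ of vertex rings whose image lies in the centre $C(U)=\{v: v_nu=0=u_nv\ \forall u\in U,\ n\ge0\}$; it is an $R$-module via $rv=\iota(r)_{-1}v$, and homomorphisms of $R$-vertex algebras are the $R$-linear maps preserving all $n$-th products and the vacuum. For an automorphism $g$ of $V$ with $g^M=\mathrm{id}$, $V^{g,r}=\{v\in V:gv=\zeta^{-r}v\}$, $0\le r<M$. The twisted loop vertex algebra is the $R$-vertex algebra $L(V,g)=\bigoplus_{0\le r<M}V^{g,r}\otimes_kt^{r/M}k[t^{\pm1}]\subset V\otimes_kS_M$, where the $n$-th products on $V\otimes_kS_M$ are $(u\otimes a)_n(v\otimes b)=\sum_{j\ge0}u_{n+j}v\otimes\frac1{j!}D^j(a)b$, and $R$ maps in via $a\mapsto\mathbf 1\otimes a$. Write $v_{(n)}=v\otimes t^n$ for $v\in V^{g,r}$, $n\in\frac rM+\mathbb Z$. A weak $g$-twisted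 $V$-module is a $k$-vector space $W$ with a linear map $Y_W(\cdot,z):V\to\mathrm{End}(W)[[z^{1/M},z^{-1/M}]]$, such that for $u\in V^{g,r}$, $v\in V$, $w\in W$: $Y_W(u,z)=\sum_{n\in\frac rM+\mathbb Z}u_nz^{-n-1}$; $u_nw=0$ for $n\gg0$; $Y_W(\mathbf 1,z)=\mathrm{id}_W$; and the twisted Jacobi identity $$z_0^{-1}\delta\Big(\tfrac{z_1-z_2}{z_0}\Big)Y_W(u,z_1)Y_W(v,z_2)-z_0^{-1}\delta\Big(\tfrac{z_2-z_1}{-z_0}\Big)Y_W(v,z_2)Y_W(u,z_1)=z_2^{-1}\Big(\tfrac{z_1-z_0}{z_2}\Big)^{-r/M}\delta\Big(\tfrac{z_1-z_0}{z_2}\Big)Y_W(Y(u,z_0)v,z_2)$$ holds, with $\delta(z)=\sum_{n\in\mathbb Z}z^n$ and binomial expressions expanded in nonnegative powers of the second variable. *)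

theory Defs
  imports
    "HOL-Computational_Algebra.Polynomial"
    "HOL-Library.Groups_Big_Fun"
    "HOL-Library.Poly_Mapping"
    "HOL-Library.Product_Plus"
begin

section \<open>Formal series and delta functions\<close>

text \<open>
  A formal series in \<open>z\<^sub>0, z\<^sub>1, z\<^sub>2\<close> with rational exponents is the function sending an exponent
  triple to the coefficient. The product of a scalar series with a vector-valued one is the Cauchy
  product; \<^const>\<open>Sum_any\<close> is the sum of a finitely supported family, and in all uses below
  only finitely many terms contribute to each coefficient.
\<close>

definition series_times ::
  "('k \<Rightarrow> 'w \<Rightarrow> 'w) \<Rightarrow> (rat \<times> rat \<times> rat \<Rightarrow> 'k) \<Rightarrow> (rat \<times> rat \<times> rat \<Rightarrow> 'w::comm_monoid_add) \<Rightarrow>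
    (rat \<times> rat \<times> rat \<Rightarrow> 'w)" where
  "series_times s K F = (\<lambda>e. Sum_any (\<lambda>d. s (K d) (F (e - d))))"

text \<open>
  The coefficient of \<open>x\<^sup>a y\<^sup>b\<close> in \<open>(x - y)\<^sup>p = (\<Sum>j\<ge>0. (p choose j) (-1)\<^sup>j x\<^sup>p\<^sup>-\<^sup>j y\<^sup>j)\<close>,
  the expansion in nonnegative powers of \<open>y\<close>.
\<close>

definition binom_diff :: "rat \<Rightarrow> rat \<Rightarrow> rat \<Rightarrow> 'k::field_char_0" where
  "binom_diff p a b =
    (if b \<in> \<nat> \<and> a + b = p
     then (-1) ^ nat \<lfloor>b\<rfloor> * (of_rat p gchoose nat \<lfloor>b\<rfloor>) else 0)"

text \<open>\<open>z\<^sub>0\<^sup>-\<^sup>1 \<delta>((z\<^sub>1 - z\<^sub>2)/z\<^sub>0) = (\<Sum>n\<in>\<int>. z\<^sub>0\<^sup>-\<^sup>n\<^sup>-\<^sup>1 (z\<^sub>1 - z\<^sub>2)\<^sup>n)\<close>\<close>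

definition delta_12 :: "rat \<times> rat \<times> rat \<Rightarrow> 'k::field_char_0" where
  "delta_12 = (\<lambda>(a, b, c). if a \<in> \<int> then binom_diff (- a - 1) b c else 0)"

text \<open>\<open>z\<^sub>0\<^sup>-\<^sup>1 \<delta>((z\<^sub>2 - z\<^sub>1)/(-z\<^sub>0)) = (\<Sum>n\<in>\<int>. (-1)\<^sup>n z\<^sub>0\<^sup>-\<^sup>n\<^sup>-\<^sup>1 (z\<^sub>2 - z\<^sub>1)\<^sup>n)\<close>\<close>

definition delta_21 :: "rat \<times> rat \<times> rat \<Rightarrow> 'k::field_char_0" where
  "delta_21 = (\<lambda>(a, b, c).
    if a \<in> \<int> then (-1) powi \<lfloor>- a - 1\<rfloor> * binom_diff (- a - 1) c b else 0)"

text \<open>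
  \<open>z\<^sub>2\<^sup>-\<^sup>1 ((z\<^sub>1 - z\<^sub>0)/z\<^sub>2)\<^sup>-\<^sup>p \<delta>((z\<^sub>1 - z\<^sub>0)/z\<^sub>2) = (\<Sum>n\<in>\<int>. z\<^sub>2\<^sup>p\<^sup>-\<^sup>n\<^sup>-\<^sup>1 (z\<^sub>1 - z\<^sub>0)\<^sup>n\<^sup>-\<^sup>p)\<close>;
  the exponent \<open>c = p - n - 1\<close> of \<open>z\<^sub>2\<close> gives \<open>n - p = - c - 1\<close>.
\<close>

definition delta_10 :: "rat \<Rightarrow> rat \<times> rat \<times> rat \<Rightarrow> 'k::field_char_0" where
  "delta_10 p = (\<lambda>(a, b, c). if c - p \<in> \<int> then binom_diff (- c - 1) b a else 0)"

text \<open>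
  The twisted Jacobi identity for \<open>u\<close>, \<open>v\<close>, applied to \<open>w\<close>, where \<open>p\<close> is the twist \<open>r/M\<close>.
  A field \<open>YW(v, z) = (\<Sum>n. v\<^sub>n z\<^sup>-\<^sup>n\<^sup>-\<^sup>1)\<close> is given by its modes, \<open>YW v n w = v\<^sub>n w\<close>, so the
  coefficient of \<open>z\<^sup>e\<close> is the mode \<open>- e - 1\<close>.
\<close>

definition twisted_jacobi ::
  "('k::field_char_0 \<Rightarrow> 'w \<Rightarrow> 'w) \<Rightarrow> ('v \<Rightarrow> int \<Rightarrow> 'v \<Rightarrow> 'v) \<Rightarrow>
   ('v \<Rightarrow> rat \<Rightarrow> 'w \<Rightarrow> 'w::ab_group_add) \<Rightarrow> rat \<Rightarrow> 'v \<Rightarrow> 'v \<Rightarrow> 'w \<Rightarrow> bool" where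
  "twisted_jacobi s Y YW p u v w \<longleftrightarrow>
    (let YuYv = (\<lambda>(a, b, c). if a = 0 then YW u (- b - 1) (YW v (- c - 1) w) else 0);
         YvYu = (\<lambda>(a, b, c). if a = 0 then YW v (- c - 1) (YW u (- b - 1) w) else 0);
         YYuv = (\<lambda>(a, b, c). if b = 0 \<and> a \<in> \<int> then YW (Y u \<lfloor>- a - 1\<rfloor> v) (- c - 1) w else 0)
     in \<forall>e. series_times s delta_12 YuYv e - series_times s delta_21 YvYu e
          = series_times s (delta_10 p) YYuv e)"

section \<open>Vertex algebras, automorphisms and twisted modules\<close>

definition int_modes :: "('v \<Rightarrow> int \<Rightarrow> 'v \<Rightarrow> 'v) \<Rightarrow> 'v \<Rightarrow> rat \<Rightarrow> 'v \<Rightarrow> 'v::zero" where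
  "int_modes Y v n = (if n \<in> \<int> then Y v \<lfloor>n\<rfloor> else (\<lambda>_. 0))"

locale vertex_algebra = vector_space scale
  for scale :: "'k::field_char_0 \<Rightarrow> 'v::ab_group_add \<Rightarrow> 'v"
  and vac :: 'v
  and Y :: "'v \<Rightarrow> int \<Rightarrow> 'v \<Rightarrow> 'v" +
  assumes linear_state: "Vector_Spaces.linear scale scale (\<lambda>v. Y v n w)"
    and linear_mode: "Vector_Spaces.linear scale scale (Y v n)"
    and regularity: "\<exists>N. \<forall>n\<ge>N. Y u n v = 0"
    and vacuum: "Y vac n v = (if n = -1 then v else 0)"
    and creation: "n \<ge> 0 \<Longrightarrow> Y v n vac = 0" "Y v (-1) vac = v"
    and jacobi: "twisted_jacobi scale Y (int_modes Y) 0 u v w"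

definition va_automorphism ::
  "('k::field_char_0 \<Rightarrow> 'v::ab_group_add \<Rightarrow> 'v) \<Rightarrow> 'v \<Rightarrow> ('v \<Rightarrow> int \<Rightarrow> 'v \<Rightarrow> 'v) \<Rightarrow> ('v \<Rightarrow> 'v) \<Rightarrow> bool" where
  "va_automorphism s vac Y g \<longleftrightarrow>
    bij g \<and> Vector_Spaces.linear s s g \<and> g vac = vac \<and> (\<forall>u n v. g (Y u n v) = Y (g u) n (g v))"

definition primitive_root_of_unity :: "nat \<Rightarrow> 'k::field \<Rightarrow> bool" where
  "primitive_root_of_unity M \<zeta> \<longleftrightarrow> \<zeta> ^ M = 1 \<and> (\<forall>j. 0 < j \<and> j < M \<longrightarrow> \<zeta> ^ j \<noteq> 1)"

definition eigenspace ::
  "('k::field \<Rightarrow> 'v \<Rightarrow> 'v) \<Rightarrow> 'k \<Rightarrow> ('v \<Rightarrow> 'v) \<Rightarrow> nat \<Rightarrow> 'v set" where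
  "eigenspace s \<zeta> g r = {v. g v = s (\<zeta> powi (- int r)) v}"

definition in_coset :: "nat \<Rightarrow> nat \<Rightarrow> rat \<Rightarrow> bool" where
  "in_coset M r n \<longleftrightarrow> n - of_nat r / of_nat M \<in> \<int>"

text \<open>Linear maps \<open>V \<rightarrow> End(W)[[z\<^sup>1\<^sup>/\<^sup>M, z\<^sup>-\<^sup>1\<^sup>/\<^sup>M]]\<close>, given by their modes.\<close>

definition linear_field_map ::
  "('k::field \<Rightarrow> 'v::ab_group_add \<Rightarrow> 'v) \<Rightarrow> nat \<Rightarrow> ('k \<Rightarrow> 'w::ab_group_add \<Rightarrow> 'w) \<Rightarrow>
   ('v \<Rightarrow> rat \<Rightarrow> 'w \<Rightarrow> 'w) \<Rightarrow> bool" where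
  "linear_field_map sV M sW YW \<longleftrightarrow>
    (\<forall>n w. Vector_Spaces.linear sV sW (\<lambda>v. YW v n w)) \<and>
    (\<forall>v n. Vector_Spaces.linear sW sW (YW v n)) \<and>
    (\<forall>v n. of_nat M * n \<notin> \<int> \<longrightarrow> YW v n = (\<lambda>_. 0))"

definition weak_twisted_module ::
  "('k::field_char_0 \<Rightarrow> 'v::ab_group_add \<Rightarrow> 'v) \<Rightarrow> 'v \<Rightarrow> ('v \<Rightarrow> int \<Rightarrow> 'v \<Rightarrow> 'v) \<Rightarrow>
   nat \<Rightarrow> 'k \<Rightarrow> ('v \<Rightarrow> 'v) \<Rightarrow>
   ('k \<Rightarrow> 'w::ab_group_add \<Rightarrow> 'w) \<Rightarrow> ('v \<Rightarrow> rat \<Rightarrow> 'w \<Rightarrow> 'w) \<Rightarrow> bool" where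
  "weak_twisted_module sV vac Y M \<zeta> g sW YW \<longleftrightarrow>
    vector_space sW \<and>
    linear_field_map sV M sW YW \<and>
    (\<forall>n w. YW vac n w = (if n = -1 then w else 0)) \<and>
    (\<forall>r<M. \<forall>u \<in> eigenspace sV \<zeta> g r.
      (\<forall>n. \<not> in_coset M r n \<longrightarrow> YW u n = (\<lambda>_. 0)) \<and>
      (\<forall>w. \<exists>N. \<forall>n\<ge>N. YW u n w = 0) \<and>
      (\<forall>v w. twisted_jacobi sW Y YW (of_nat r / of_nat M) u v w))"

section \<open>Laurent polynomials and twisted loop vertex algebras\<close>

text \<open>
  \<^typ>\<open>rat \<Rightarrow>\<^sub>0 'k\<close> is the ring of Laurent polynomials in \<open>t\<close> with rational exponents,
  which contains each \<open>S\<^sub>M = k[t\<^sup>\<plusminus>\<^sup>1\<^sup>/\<^sup>M]\<close> as the elements with exponents in \<open>(1/M)\<int>\<close>;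
  \<open>R = k[t\<^sup>\<plusminus>\<^sup>1]\<close> is the ring \<^typ>\<open>int \<Rightarrow>\<^sub>0 'k\<close>.
  Likewise \<open>V \<otimes> S\<^sub>M\<close> sits inside \<^typ>\<open>rat \<Rightarrow>\<^sub>0 'v\<close>, with \<open>v \<otimes> t\<^sup>q\<close> the function \<open>single q v\<close>.
\<close>

definition laurent_deriv :: "(rat \<Rightarrow>\<^sub>0 'k::field_char_0) \<Rightarrow> (rat \<Rightarrow>\<^sub>0 'k)" where
  "laurent_deriv a =
    (\<Sum>q\<in>Poly_Mapping.keys a.
      Poly_Mapping.single (q - 1) (of_rat q * Poly_Mapping.lookup a q))"

definition laurent_embed :: "(int \<Rightarrow>\<^sub>0 'k::field_char_0) \<Rightarrow> (rat \<Rightarrow>\<^sub>0 'k)" where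
  "laurent_embed a =
    (\<Sum>n\<in>Poly_Mapping.keys a. Poly_Mapping.single (of_int n) (Poly_Mapping.lookup a n))"

definition tensor :: "('k::zero \<Rightarrow> 'v::zero \<Rightarrow> 'v) \<Rightarrow> 'v \<Rightarrow> (rat \<Rightarrow>\<^sub>0 'k) \<Rightarrow> (rat \<Rightarrow>\<^sub>0 'v)" where
  "tensor s v a = Poly_Mapping.map (\<lambda>c. s c v) a"

text \<open>
  The biadditive extension of
  \<open>(u \<otimes> a)\<^sub>n (v \<otimes> b) = (\<Sum>j\<ge>0. u\<^sub>n\<^sub>+\<^sub>j v \<otimes> (D\<^sup>j a / j!) b)\<close> from \<open>a = t\<^sup>p\<close>, \<open>b = t\<^sup>q\<close>.
\<close>

definition loop_product ::
  "('k::field_char_0 \<Rightarrow> 'v::ab_group_add \<Rightarrow> 'v) \<Rightarrow> ('v \<Rightarrow> int \<Rightarrow> 'v \<Rightarrow> 'v) \<Rightarrow>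
   int \<Rightarrow> (rat \<Rightarrow>\<^sub>0 'v) \<Rightarrow> (rat \<Rightarrow>\<^sub>0 'v) \<Rightarrow> (rat \<Rightarrow>\<^sub>0 'v)" where
  "loop_product s Y n x y =
    (\<Sum>p\<in>Poly_Mapping.keys x. \<Sum>q\<in>Poly_Mapping.keys y.
      Sum_any (\<lambda>j::nat.
        tensor s (Y (Poly_Mapping.lookup x p) (n + int j) (Poly_Mapping.lookup y q))
          (Poly_Mapping.single 0 (1 / fact j) *
           (laurent_deriv ^^ j) (Poly_Mapping.single p 1) * Poly_Mapping.single q 1)))"

text \<open>
  The data of an \<open>R\<close>-vertex algebra: underlying additive group (a subset of an ambient one),
  \<open>n\<close>-th products, vacuum, and the structure map \<open>\<iota>\<close> from \<open>R\<close>
  (of type \<^typ>\<open>'r\<close>).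
\<close>

record ('r, 'u) R_vertex_algebra_data =
  va_carrier :: "'u set"
  va_product :: "int \<Rightarrow> 'u \<Rightarrow> 'u \<Rightarrow> 'u"
  va_vacuum :: 'u
  va_iota :: "'r \<Rightarrow> 'u"

definition R_smult :: "('r, 'u) R_vertex_algebra_data \<Rightarrow> 'r \<Rightarrow> 'u \<Rightarrow> 'u" where
  "R_smult A a x = va_product A (-1) (va_iota A a) x"

definition R_vertex_algebra_hom ::
  "('r, 'a::ab_group_add) R_vertex_algebra_data \<Rightarrow>
   ('r, 'b::ab_group_add) R_vertex_algebra_data \<Rightarrow> ('a \<Rightarrow> 'b) \<Rightarrow> bool" where
  "R_vertex_algebra_hom A B \<phi> \<longleftrightarrow>
    (\<forall>x\<in>va_carrier A. \<phi> x \<in> va_carrier B) \<and>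
    (\<forall>x\<in>va_carrier A. \<forall>y\<in>va_carrier A. \<phi> (x + y) = \<phi> x + \<phi> y) \<and>
    (\<forall>a. \<forall>x\<in>va_carrier A. \<phi> (R_smult A a x) = R_smult B a (\<phi> x)) \<and>
    (\<forall>n. \<forall>x\<in>va_carrier A. \<forall>y\<in>va_carrier A.
      \<phi> (va_product A n x y) = va_product B n (\<phi> x) (\<phi> y)) \<and>
    \<phi> (va_vacuum A) = va_vacuum B"

text \<open>\<open>L(V, g)\<close>, the direct sum over \<open>0 \<le> r < M\<close> of \<open>V\<^sup>g\<^sup>,\<^sup>r \<otimes> t\<^sup>r\<^sup>/\<^sup>M k[t\<^sup>\<plusminus>\<^sup>1]\<close>.\<close>

definition twisted_loop ::
  "('k::field_char_0 \<Rightarrow> 'v::ab_group_add \<Rightarrow> 'v) \<Rightarrow> 'v \<Rightarrow> ('v \<Rightarrow> int \<Rightarrow> 'v \<Rightarrow> 'v) \<Rightarrow>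
   nat \<Rightarrow> 'k \<Rightarrow> ('v \<Rightarrow> 'v) \<Rightarrow> (int \<Rightarrow>\<^sub>0 'k, rat \<Rightarrow>\<^sub>0 'v) R_vertex_algebra_data" where
  "twisted_loop s vac Y M \<zeta> g =
    \<lparr> va_carrier = {x. \<forall>n\<in>Poly_Mapping.keys x.
        \<exists>r<M. in_coset M r n \<and> Poly_Mapping.lookup x n \<in> eigenspace s \<zeta> g r},
      va_product = loop_product s Y,
      va_vacuum = Poly_Mapping.single 0 vac,
      va_iota = (\<lambda>a. tensor s vac (laurent_embed a)) \<rparr>"

section \<open>Pullback along a homomorphism of twisted loop algebras\<close>

text \<open>The linear map sending \<open>v\<^sub>(\<^sub>n\<^sub>) = v \<otimes> t\<^sup>n\<close> to the mode \<open>v\<^sub>n\<close>.\<close>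

definition mode_map ::
  "('v::zero \<Rightarrow> rat \<Rightarrow> 'w \<Rightarrow> 'w::comm_monoid_add) \<Rightarrow> (rat \<Rightarrow>\<^sub>0 'v) \<Rightarrow> 'w \<Rightarrow> 'w" where
  "mode_map YW x = (\<lambda>w. \<Sum>n\<in>Poly_Mapping.keys x. YW (Poly_Mapping.lookup x n) n w)"

text \<open>
  \<open>Y'\<close> is the linear map \<open>\<phi>\<^sup>*YW\<close>: it is prescribed on each \<open>V\<^sup>g\<^sup>,\<^sup>r\<close> and extended linearly to \<open>V\<close>.
\<close>

definition is_pullback ::
  "('k::field \<Rightarrow> 'v::ab_group_add \<Rightarrow> 'v) \<Rightarrow> nat \<Rightarrow> 'k \<Rightarrow> ('v \<Rightarrow> 'v) \<Rightarrow>
   ('k \<Rightarrow> 'w::ab_group_add \<Rightarrow> 'w) \<Rightarrow> ((rat \<Rightarrow>\<^sub>0 'v) \<Rightarrow> (rat \<Rightarrow>\<^sub>0 'v)) \<Rightarrow>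
   ('v \<Rightarrow> rat \<Rightarrow> 'w \<Rightarrow> 'w) \<Rightarrow> ('v \<Rightarrow> rat \<Rightarrow> 'w \<Rightarrow> 'w) \<Rightarrow> bool" where
  "is_pullback sV M \<zeta> g sW \<phi> YW Y' \<longleftrightarrow>
    linear_field_map sV M sW Y' \<and>
    (\<forall>r<M. \<forall>v \<in> eigenspace sV \<zeta> g r. \<forall>n.
      Y' v n = (if in_coset M r n then mode_map YW (\<phi> (Poly_Mapping.single n v)) else (\<lambda>_. 0)))"

end

theory Submission
  imports Defs
begin

text \<open>
  Taking coefficients in the twisted Jacobi identity turns it into the family of identities
  \[
    \sum_{j \ge 0} (-1)^j \binom{l}{j} \bigl( u_{m+l-j} v_{n+j} - (-1)^l v_{n+l-j} u_{m+j} \bigr) w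
      = \sum_{j \ge 0} \binom{m}{j} (u_{l+j} v)_{m+n-j} w ,
  \]
  one for each integer \<open>l\<close>, each \<open>m\<close> in the coset \<open>r/M + \<int>\<close> of \<open>u\<close> and each rational \<open>n\<close>. The
  binomial coefficient on the right is the one in
  \<open>(u \<otimes> t\<^sup>m)\<^sub>l (v \<otimes> t\<^sup>n) = (\<Sum>j\<ge>0. (m choose j) (u\<^sub>l\<^sub>+\<^sub>j v) \<otimes> t\<^sup>m\<^sup>+\<^sup>n\<^sup>-\<^sup>j)\<close>, and lowering or raising a
  mode index by an integer is multiplication by a power of \<open>t\<close>. Writing \<open>\<pi>\<close> for the map
  \<open>v \<otimes> t\<^sup>n \<mapsto> v\<^sub>n\<close>, the identities for an \<open>h\<close>-twisted module say exactly that
  \[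
    \sum_{j \ge 0} (-1)^j \binom{l}{j}
      \bigl( \pi(t^{l-j} x) \pi(t^j y) - (-1)^l \pi(t^{l-j} y) \pi(t^j x) \bigr) = \pi(x_l y)
  \]
  for monomials \<open>x\<close>, \<open>y\<close>, hence by biadditivity for all \<open>x, y \<in> L(V, h)\<close> (lemma \<open>loop_borcherds\<close>).
  This form mentions only the \<open>k[t\<^sup>\<plusminus>\<^sup>1]\<close>-action and the \<open>l\<close>-th product, both of which a homomorphism
  \<open>\<phi>\<close> respects, so \<open>\<pi> \<circ> \<phi>\<close> satisfies it on \<open>L(V, g)\<close>; read on monomials, it is the Jacobi
  identity of the pullback (lemma \<open>borcherds_pullback_homogeneous\<close>). Truncation holds for a similar
  reason: the modes of \<open>u\<close> are \<open>\<pi>(t\<^sup>i x)\<close> for a single \<open>x = \<phi>(u \<otimes> t\<^sup>r\<^sup>/\<^sup>M)\<close>, which involves finitely many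
  states.

  The pullback is prescribed only on eigenvectors of \<open>g\<close>. Since \<open>g\<close> has finite order and the
  field contains a primitive \<open>M\<close>-th root of unity, \<open>V\<close> is the direct sum of the eigenspaces of \<open>g\<close>;
  this gives existence and uniqueness of the linear extension, and reduces statements about
  arbitrary \<open>v\<close> to eigenvectors.
\<close>

section \<open>The twisted Jacobi identity in modes\<close>

text \<open>
  Reindexing preserves whether the support is finite, and a family with infinite support has sum
  \<open>0\<close> on both sides.
\<close>

lemma Sum_any_reindex:
  fixes f :: "'a \<Rightarrow> 'b::comm_monoid_add"
  assumes "inj \<iota>" and "\<And>d. f d \<noteq> 0 \<Longrightarrow> d \<in> range \<iota>"
  shows "Sum_any f = Sum_any (\<lambda>j. f (\<iota> j))"
proof -
  have supp: "{d. f d \<noteq> 0} = \<iota> ` {j. f (\<iota> j) \<noteq> 0}"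
    using assms(2) by blast
  show ?thesis
    unfolding Sum_any.expand_set supp
    using assms(1) by (subst sum.reindex) (auto intro: inj_on_subset simp: o_def)
qed

lemma Sum_any_eventually_lessThan:
  fixes f :: "nat \<Rightarrow> 'b::comm_monoid_add"
  assumes "\<forall>\<^sub>F j in sequentially. f j = 0"
  shows "\<forall>\<^sub>F N in sequentially. Sum_any f = sum f {..<N}"
proof -
  obtain N0 where N0: "\<And>j. j \<ge> N0 \<Longrightarrow> f j = 0"
    using assms by (auto simp: eventually_sequentially)
  have "Sum_any f = sum f {..<N}" if "N \<ge> N0" for N
    using N0 that by (intro Sum_any.expand_superset) (auto simp: not_less[symmetric] intro: ccontr)
  then show ?thesis
    by (auto simp: eventually_sequentially)
qed

text \<open>
  The summands of the identity in modes. The product term serves both products of fields; the one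
  in the opposite order arises by exchanging \<open>u\<close> with \<open>v\<close> and \<open>m\<close> with \<open>n\<close>.
\<close>

definition product_term ::
  "('k::field_char_0 \<Rightarrow> 'w \<Rightarrow> 'w) \<Rightarrow> ('v \<Rightarrow> rat \<Rightarrow> 'w \<Rightarrow> 'w) \<Rightarrow>
    'v \<Rightarrow> 'v \<Rightarrow> 'w \<Rightarrow> int \<Rightarrow> rat \<Rightarrow> rat \<Rightarrow> nat \<Rightarrow> 'w" where
  "product_term s YW u v w l m n j =
    s ((-1) ^ j * (of_int l gchoose j)) (YW u (m + of_int l - of_nat j) (YW v (n + of_nat j) w))"

definition iterate_term ::
  "('k::field_char_0 \<Rightarrow> 'w \<Rightarrow> 'w) \<Rightarrow> ('v \<Rightarrow> int \<Rightarrow> 'v \<Rightarrow> 'v) \<Rightarrow> ('v \<Rightarrow> rat \<Rightarrow> 'w \<Rightarrow> 'w) \<Rightarrow>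
    'v \<Rightarrow> 'v \<Rightarrow> 'w \<Rightarrow> int \<Rightarrow> rat \<Rightarrow> rat \<Rightarrow> nat \<Rightarrow> 'w" where
  "iterate_term s Y YW u v w l m n j =
    s (of_rat m gchoose j) (YW (Y u (l + int j) v) (m + n - of_nat j) w)"

text \<open>
  All three sums are finite once the fields are truncated. Asking for the equality of all
  sufficiently long partial sums avoids naming a bound, and makes sums of several such identities
  easy to form.
\<close>

definition borcherds_identity ::
  "('k::field_char_0 \<Rightarrow> 'w::ab_group_add \<Rightarrow> 'w) \<Rightarrow> ('v \<Rightarrow> int \<Rightarrow> 'v \<Rightarrow> 'v) \<Rightarrow>
    ('v \<Rightarrow> rat \<Rightarrow> 'w \<Rightarrow> 'w) \<Rightarrow> 'v \<Rightarrow> 'v \<Rightarrow> 'w \<Rightarrow> int \<Rightarrow> rat \<Rightarrow> rat \<Rightarrow> bool" where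
  "borcherds_identity s Y YW u v w l m n \<longleftrightarrow>
    (\<forall>\<^sub>F N in sequentially.
      (\<Sum>j<N. product_term s YW u v w l m n j)
        - s ((-1) powi l) (\<Sum>j<N. product_term s YW v u w l n m j)
      = (\<Sum>j<N. iterate_term s Y YW u v w l m n j))"

lemma binom_diff_nonzeroE:
  assumes "binom_diff p a b \<noteq> 0"
  obtains j where "a = p - of_nat j" and "b = of_nat j"
  using assms by (auto simp: binom_diff_def eq_diff_eq elim!: Nats_cases split: if_splits)

text \<open>
  The coefficient of \<open>z\<^sub>0\<^sup>-\<^sup>l\<^sup>-\<^sup>1 z\<^sub>1\<^sup>-\<^sup>m\<^sup>-\<^sup>1 z\<^sub>2\<^sup>-\<^sup>n\<^sup>-\<^sup>1\<close> is extracted from each of the three products of series: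
  in each, the exponents that contribute are parametrised by the summation index of one binomial
  expansion. On the right, the binomial coefficient \<open>(-1)\<^sup>j (j - m - 1 choose j)\<close>
  equals \<open>(m choose j)\<close> by upper negation. The remaining coefficients vanish on both sides: for
  \<open>l \<notin> \<int>\<close> because of the exponents of \<open>z\<^sub>0\<close> in the delta functions, and for \<open>m \<notin> p + \<int>\<close> because then
  all modes of \<open>u\<close> that occur are zero.
\<close>

lemma twisted_jacobi_coefficients:
  fixes s :: "'k::field_char_0 \<Rightarrow> 'w::ab_group_add \<Rightarrow> 'w"
  assumes "vector_space s"
    and coset: "\<And>n. n - p \<notin> \<int> \<Longrightarrow> YW u n = (\<lambda>_. 0)"
    and zero: "\<And>n. YW v n 0 = 0"
  shows "twisted_jacobi s Y YW p u v w \<longleftrightarrow>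
    (\<forall>l m n. m - p \<in> \<int> \<longrightarrow>
      Sum_any (product_term s YW u v w l m n)
        - Sum_any (\<lambda>j. s ((-1) powi l) (product_term s YW v u w l n m j))
      = Sum_any (iterate_term s Y YW u v w l m n))"
proof -
  interpret W: vector_space s by fact
  define F1 where "F1 = (\<lambda>(a::rat, b, c). if a = 0 then YW u (- b - 1) (YW v (- c - 1) w) else 0)"
  define F2 where "F2 = (\<lambda>(a::rat, b, c). if a = 0 then YW v (- c - 1) (YW u (- b - 1) w) else 0)"
  define F3 where "F3 = (\<lambda>(a::rat, b::rat, c).
    if b = 0 \<and> a \<in> \<int> then YW (Y u \<lfloor>- a - 1\<rfloor> v) (- c - 1) w else 0)"
  have tj: "twisted_jacobi s Y YW p u v w \<longleftrightarrow> (\<forall>e. series_times s delta_12 F1 e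
      - series_times s delta_21 F2 e = series_times s (delta_10 p) F3 e)"
    unfolding twisted_jacobi_def F1_def F2_def F3_def Let_def ..
  have c1: "series_times s delta_12 F1 (- of_int l - 1, - m - 1, - n - 1)
      = Sum_any (product_term s YW u v w l m n)" for l m n
  proof -
    define \<iota> where "\<iota> j = (- of_int l - 1 :: rat, of_int l - of_nat j :: rat, of_nat j :: rat)" for j
    have "inj \<iota>" by (auto simp: inj_def \<iota>_def)
    moreover have "d \<in> range \<iota>"
      if "s (delta_12 d) (F1 ((- of_int l - 1, - m - 1, - n - 1) - d)) \<noteq> 0" for d
    proof -
      obtain x y z where d: "d = (x, y, z)" by (cases d)
      have "x = - of_int l - 1" and "binom_diff (- x - 1) y z \<noteq> (0 :: 'k)"
        using that by (auto simp: d delta_12_def F1_def minus_prod_def split: if_splits)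
      then obtain j where "(x, y, z) = \<iota> j"
        by (auto simp: \<iota>_def elim!: binom_diff_nonzeroE)
      then show ?thesis by (simp add: d)
    qed
    ultimately have "series_times s delta_12 F1 (- of_int l - 1, - m - 1, - n - 1)
      = Sum_any (\<lambda>j. s (delta_12 (\<iota> j)) (F1 ((- of_int l - 1, - m - 1, - n - 1) - \<iota> j)))"
      unfolding series_times_def by (rule Sum_any_reindex)
    also have "(\<lambda>j. s (delta_12 (\<iota> j)) (F1 ((- of_int l - 1, - m - 1, - n - 1) - \<iota> j)))
      = product_term s YW u v w l m n"
      by (rule ext) (simp add: delta_12_def F1_def \<iota>_def binom_diff_def minus_prod_def
          product_term_def algebra_simps)
    finally show ?thesis .
  qed
  have c2: "series_times s delta_21 F2 (- of_int l - 1, - m - 1, - n - 1)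
      = Sum_any (\<lambda>j. s ((-1) powi l) (product_term s YW v u w l n m j))" for l m n
  proof -
    define \<iota> where "\<iota> j = (- of_int l - 1 :: rat, of_nat j :: rat, of_int l - of_nat j :: rat)" for j
    have "inj \<iota>" by (auto simp: inj_def \<iota>_def)
    moreover have "d \<in> range \<iota>"
      if "s (delta_21 d) (F2 ((- of_int l - 1, - m - 1, - n - 1) - d)) \<noteq> 0" for d
    proof -
      obtain x y z where d: "d = (x, y, z)" by (cases d)
      have "x = - of_int l - 1" and "binom_diff (- x - 1) z y \<noteq> (0 :: 'k)"
        using that by (auto simp: d delta_21_def F2_def minus_prod_def split: if_splits)
      then obtain j where "(x, y, z) = \<iota> j"
        by (auto simp: \<iota>_def elim!: binom_diff_nonzeroE)
      then show ?thesis by (simp add: d)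
    qed
    ultimately have "series_times s delta_21 F2 (- of_int l - 1, - m - 1, - n - 1)
      = Sum_any (\<lambda>j. s (delta_21 (\<iota> j)) (F2 ((- of_int l - 1, - m - 1, - n - 1) - \<iota> j)))"
      unfolding series_times_def by (rule Sum_any_reindex)
    also have "(\<lambda>j. s (delta_21 (\<iota> j)) (F2 ((- of_int l - 1, - m - 1, - n - 1) - \<iota> j)))
      = (\<lambda>j. s ((-1) powi l) (product_term s YW v u w l n m j))"
      by (rule ext) (simp add: delta_21_def F2_def \<iota>_def binom_diff_def minus_prod_def
          product_term_def algebra_simps)
    finally show ?thesis .
  qed
  have c3: "series_times s (delta_10 p) F3 (- of_int l - 1, - m - 1, - n - 1)
      = Sum_any (iterate_term s Y YW u v w l m n)" if m: "m - p \<in> \<int>" for l m n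
  proof -
    define \<iota> where "\<iota> j = (of_nat j :: rat, - m - 1 :: rat, m - of_nat j :: rat)" for j
    have "inj \<iota>" by (auto simp: inj_def \<iota>_def)
    moreover have "d \<in> range \<iota>"
      if "s (delta_10 p d) (F3 ((- of_int l - 1, - m - 1, - n - 1) - d)) \<noteq> 0" for d
    proof -
      obtain x y z where d: "d = (x, y, z)" by (cases d)
      have "y = - m - 1" and "binom_diff (- z - 1) y x \<noteq> (0 :: 'k)"
        using that by (auto simp: d delta_10_def F3_def minus_prod_def split: if_splits)
      then obtain j where "(x, y, z) = \<iota> j"
        by (force simp: \<iota>_def algebra_simps elim!: binom_diff_nonzeroE)
      then show ?thesis by (simp add: d)
    qed
    ultimately have "series_times s (delta_10 p) F3 (- of_int l - 1, - m - 1, - n - 1)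
      = Sum_any (\<lambda>j. s (delta_10 p (\<iota> j)) (F3 ((- of_int l - 1, - m - 1, - n - 1) - \<iota> j)))"
      unfolding series_times_def by (rule Sum_any_reindex)
    also have "(\<lambda>j. s (delta_10 p (\<iota> j)) (F3 ((- of_int l - 1, - m - 1, - n - 1) - \<iota> j)))
      = iterate_term s Y YW u v w l m n"
    proof (rule ext)
      fix j
      have "m - of_nat j - p \<in> \<int>"
        using Ints_diff[OF m Ints_of_nat[of j]] by (simp add: algebra_simps)
      then have d: "delta_10 p (\<iota> j) = (of_rat m gchoose j :: 'k)"
        by (simp add: delta_10_def \<iota>_def binom_diff_def gbinomial_negated_upper[of "of_rat m" j]
            of_rat_diff of_rat_add algebra_simps)
      have z: "(- of_int l - 1) - of_nat j = (of_int (- l - 1 - int j) :: rat)" by simp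
      have "\<lfloor>- (of_int (- l - 1 - int j) :: rat) - 1\<rfloor> = l + int j"
        by (simp add: floor_eq_iff)
      then show "s (delta_10 p (\<iota> j)) (F3 ((- of_int l - 1, - m - 1, - n - 1) - \<iota> j))
          = iterate_term s Y YW u v w l m n j"
        unfolding d iterate_term_def
        by (simp add: F3_def \<iota>_def minus_prod_def z del: of_int_diff of_int_minus) (simp add: algebra_simps)
    qed
    finally show ?thesis .
  qed
  \<comment> \<open>Exponents of \<open>z\<^sub>0\<close> that are not integers.\<close>
  have off: "series_times s delta_12 F1 (a, b, c) - series_times s delta_21 F2 (a, b, c)
      = series_times s (delta_10 p) F3 (a, b, c)" if "a \<notin> \<int>" for a b c
  proof -
    have "s (delta_12 d) (F1 ((a, b, c) - d)) = 0" for d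
      using that by (cases d) (auto simp: delta_12_def F1_def minus_prod_def)
    moreover have "s (delta_21 d) (F2 ((a, b, c) - d)) = 0" for d
      using that by (cases d) (auto simp: delta_21_def F2_def minus_prod_def)
    moreover have "s (delta_10 p d) (F3 ((a, b, c) - d)) = 0" for d
    proof -
      obtain x y z where d: "d = (x, y, z)" by (cases d)
      have "\<not> (x \<in> \<nat> \<and> a - x \<in> \<int>)"
        using that Ints_add[of x "a - x"] Nats_subset_Ints by auto
      then show ?thesis
        by (auto simp: d delta_10_def F3_def minus_prod_def binom_diff_def)
    qed
    ultimately show ?thesis
      by (simp add: series_times_def del: W.scale_eq_0_iff)
  qed
  \<comment> \<open>Exponents of \<open>z\<^sub>1\<close> outside the coset of the modes of \<open>u\<close>.\<close>
  have off': "series_times s delta_12 F1 (- of_int l - 1, - m - 1, - n - 1)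
        - series_times s delta_21 F2 (- of_int l - 1, - m - 1, - n - 1)
      = series_times s (delta_10 p) F3 (- of_int l - 1, - m - 1, - n - 1)"
    if m: "m - p \<notin> \<int>" for l m n
  proof -
    have u: "YW u (m + of_int i) = (\<lambda>_. 0)" for i :: int
    proof (rule coset, rule notI)
      assume "m + of_int i - p \<in> \<int>"
      then show False
        using m Ints_diff[of "m + of_int i - p" "of_int i"] by (simp add: algebra_simps)
    qed
    have "product_term s YW u v w l m n j = 0" for j
      using u[of "l - int j"] by (simp add: product_term_def add_diff_eq)
    moreover have "product_term s YW v u w l n m j = 0" for j
      using u[of "int j"] by (simp add: product_term_def zero)
    moreover have "s (delta_10 p d) (F3 ((- of_int l - 1, - m - 1, - n - 1) - d)) = 0" for d
    proof -
      obtain x y z where d: "d = (x, y, z)" by (cases d)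
      show ?thesis
      proof (rule ccontr)
        assume "\<not> ?thesis"
        then have *: "x \<in> \<nat>" "y + x = - z - 1" "z - p \<in> \<int>" "- m - 1 - y = 0"
          by (auto simp: d delta_10_def F3_def minus_prod_def binom_diff_def split: if_splits)
        then have "m - p = (z - p) + x" by simp
        also have "\<dots> \<in> \<int>" using * Nats_subset_Ints by (intro Ints_add) auto
        finally show False using m by simp
      qed
    qed
    ultimately show ?thesis
      unfolding c1 c2 by (simp add: series_times_def del: W.scale_eq_0_iff)
  qed
  show ?thesis
  proof
    assume "twisted_jacobi s Y YW p u v w"
    then show "\<forall>l m n. m - p \<in> \<int> \<longrightarrow>
      Sum_any (product_term s YW u v w l m n)
        - Sum_any (\<lambda>j. s ((-1) powi l) (product_term s YW v u w l n m j))
      = Sum_any (iterate_term s Y YW u v w l m n)"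
      unfolding tj by (metis c1 c2 c3)
  next
    assume R: "\<forall>l m n. m - p \<in> \<int> \<longrightarrow>
      Sum_any (product_term s YW u v w l m n)
        - Sum_any (\<lambda>j. s ((-1) powi l) (product_term s YW v u w l n m j))
      = Sum_any (iterate_term s Y YW u v w l m n)"
    show "twisted_jacobi s Y YW p u v w"
      unfolding tj
    proof
      fix e :: "rat \<times> rat \<times> rat"
      obtain a b c where e: "e = (a, b, c)" by (cases e)
      show "series_times s delta_12 F1 e - series_times s delta_21 F2 e
          = series_times s (delta_10 p) F3 e"
      proof (cases "a \<in> \<int>")
        case True
        then obtain i where "a = of_int i" by (auto elim: Ints_cases)
        then have "e = (- of_int (- i - 1) - 1, - (- b - 1) - 1, - (- c - 1) - 1)"
          by (simp add: e)
        then show ?thesis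
          using R c1 c2 c3 off' by (cases "(- b - 1) - p \<in> \<int>") metis+
      qed (simp add: e off)
    qed
  qed
qed

lemma truncation_eventually_nat:
  fixes f :: "rat \<Rightarrow> 'w::zero"
  assumes "\<exists>N. \<forall>n\<ge>N. f n = 0"
  shows "\<forall>\<^sub>F j in sequentially. f (n + of_nat j) = 0"
proof -
  obtain N where N: "\<And>n. n \<ge> N \<Longrightarrow> f n = 0" using assms by blast
  obtain J :: nat where J: "N - n < of_nat J" using reals_Archimedean2 by blast
  have "f (n + of_nat j) = 0" if "j \<ge> J" for j
  proof (rule N)
    have "(of_nat J :: rat) \<le> of_nat j" using that by simp
    then show "N \<le> n + of_nat j" using J by linarith
  qed
  then show ?thesis by (auto simp: eventually_sequentially)
qed

lemma regularity_eventually_nat: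
  fixes f :: "int \<Rightarrow> 'w::zero"
  assumes "\<exists>N. \<forall>n\<ge>N. f n = 0"
  shows "\<forall>\<^sub>F j in sequentially. f (l + int j) = 0"
proof -
  obtain N where N: "\<And>n. n \<ge> N \<Longrightarrow> f n = 0" using assms by blast
  have "f (l + int j) = 0" if "j \<ge> nat (N - l)" for j
    using that by (intro N) linarith
  then show ?thesis by (auto simp: eventually_sequentially)
qed

lemma twisted_jacobi_iff_borcherds_identity:
  fixes s :: "'k::field_char_0 \<Rightarrow> 'w::ab_group_add \<Rightarrow> 'w"
  assumes vs: "vector_space s"
    and coset: "\<And>n. n - p \<notin> \<int> \<Longrightarrow> YW u n = (\<lambda>_. 0)"
    and zero: "\<And>n. YW u n 0 = 0" "\<And>n. YW v n 0 = 0" "\<And>n. YW 0 n w = 0"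
    and trunc: "\<exists>N. \<forall>n\<ge>N. YW u n w = 0" "\<exists>N. \<forall>n\<ge>N. YW v n w = 0"
    and reg: "\<exists>N. \<forall>n\<ge>N. Y u n v = 0"
  shows "twisted_jacobi s Y YW p u v w \<longleftrightarrow>
    (\<forall>l m n. m - p \<in> \<int> \<longrightarrow> borcherds_identity s Y YW u v w l m n)"
proof -
  interpret W: vector_space s by fact
  have "(Sum_any (product_term s YW u v w l m n)
        - Sum_any (\<lambda>j. s ((-1) powi l) (product_term s YW v u w l n m j))
      = Sum_any (iterate_term s Y YW u v w l m n)) \<longleftrightarrow>
    borcherds_identity s Y YW u v w l m n" (is "?P \<longleftrightarrow> _") for l m n
  proof -
    have "\<forall>\<^sub>F N in sequentially. Sum_any (product_term s YW u v w l m n)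
        = (\<Sum>j<N. product_term s YW u v w l m n j)"
      using truncation_eventually_nat[OF trunc(2), of n]
      by (intro Sum_any_eventually_lessThan) (auto elim!: eventually_mono simp: product_term_def zero)
    moreover have "\<forall>\<^sub>F N in sequentially.
        Sum_any (\<lambda>j. s ((-1) powi l) (product_term s YW v u w l n m j))
        = (\<Sum>j<N. s ((-1) powi l) (product_term s YW v u w l n m j))"
      using truncation_eventually_nat[OF trunc(1), of m]
      by (intro Sum_any_eventually_lessThan) (auto elim!: eventually_mono simp: product_term_def zero)
    moreover have "\<forall>\<^sub>F N in sequentially. Sum_any (iterate_term s Y YW u v w l m n)
        = (\<Sum>j<N. iterate_term s Y YW u v w l m n j)"
      using regularity_eventually_nat[OF reg, of l]
      by (intro Sum_any_eventually_lessThan) (auto elim!: eventually_mono simp: iterate_term_def zero)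
    ultimately have "\<forall>\<^sub>F N in sequentially. ?P \<longleftrightarrow>
        ((\<Sum>j<N. product_term s YW u v w l m n j)
          - s ((-1) powi l) (\<Sum>j<N. product_term s YW v u w l n m j)
        = (\<Sum>j<N. iterate_term s Y YW u v w l m n j))"
      by eventually_elim (simp only: W.scale_sum_right)
    then have "(\<forall>\<^sub>F N::nat in sequentially. ?P) \<longleftrightarrow> borcherds_identity s Y YW u v w l m n"
      unfolding borcherds_identity_def by (rule eventually_subst)
    then show ?thesis by simp
  qed
  then show ?thesis
    using twisted_jacobi_coefficients[where s = s and YW = YW, OF vs coset zero(2)] by simp
qed

section \<open>Field maps evaluated on loop elements\<close>

lemma sum_keys_superset:
  assumes "finite A" and "Poly_Mapping.keys x \<subseteq> A" and "\<And>q. f q 0 = 0"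
  shows "(\<Sum>q\<in>Poly_Mapping.keys x. f q (Poly_Mapping.lookup x q))
    = (\<Sum>q\<in>A. f q (Poly_Mapping.lookup x q))"
  using assms by (intro sum.mono_neutral_left) (auto simp: in_keys_iff)

lemma sum_keys_single:
  assumes "f p 0 = 0"
  shows "(\<Sum>q\<in>Poly_Mapping.keys (Poly_Mapping.single p v).
    f q (Poly_Mapping.lookup (Poly_Mapping.single p v) q)) = f p v"
  using assms by simp

lemma linearD:
  assumes "Vector_Spaces.linear s1 s2 f"
  shows "f 0 = 0" "f (x + y) = f x + f y" "f (s1 c x) = s2 c (f x)"
    "f (\<Sum>a\<in>A. h a) = (\<Sum>a\<in>A. f (h a))"
proof -
  interpret Vector_Spaces.linear s1 s2 f by fact
  show "f 0 = 0" "f (x + y) = f x + f y" "f (s1 c x) = s2 c (f x)"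
    "f (\<Sum>a\<in>A. h a) = (\<Sum>a\<in>A. f (h a))"
    by (rule zero add scale sum)+
qed

text \<open>
  For integral \<open>i\<close> this is the image of \<open>t\<^sup>i x\<close> under \<open>v \<otimes> t\<^sup>q \<mapsto> v\<^sub>q\<close>. Shifting the modes instead of the
  element keeps the sum over the exponents of \<open>x\<close> itself.
\<close>

definition shifted_modes ::
  "('v::zero \<Rightarrow> rat \<Rightarrow> 'w \<Rightarrow> 'w::comm_monoid_add) \<Rightarrow> rat \<Rightarrow> (rat \<Rightarrow>\<^sub>0 'v) \<Rightarrow> 'w \<Rightarrow> 'w" where
  "shifted_modes YW i x w =
    (\<Sum>q\<in>Poly_Mapping.keys x. YW (Poly_Mapping.lookup x q) (q + i) w)"

lemma mode_map_eq_shifted_modes: "mode_map YW x = shifted_modes YW 0 x"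
  by (simp add: mode_map_def shifted_modes_def fun_eq_iff)

locale field_map = V: vector_space sV + W: vector_space sW
  for sV :: "'k::field_char_0 \<Rightarrow> 'v::ab_group_add \<Rightarrow> 'v"
    and sW :: "'k \<Rightarrow> 'w::ab_group_add \<Rightarrow> 'w" +
  fixes M :: nat and YW :: "'v \<Rightarrow> rat \<Rightarrow> 'w \<Rightarrow> 'w"
  assumes linear_field_map: "linear_field_map sV M sW YW"
begin

lemma linear_state: "Vector_Spaces.linear sV sW (\<lambda>v. YW v n w)"
  and linear_mode: "Vector_Spaces.linear sW sW (YW v n)"
  using linear_field_map by (auto simp: linear_field_map_def)

lemmas state_simps [simp] = linearD(1-3)[OF linear_state]
lemmas mode_simps [simp] = linearD(1-3)[OF linear_mode]
lemmas mode_sum = linearD(4)[OF linear_mode]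

lemma shifted_modes_superset:
  assumes "finite A" and "Poly_Mapping.keys x \<subseteq> A"
  shows "shifted_modes YW i x w = (\<Sum>q\<in>A. YW (Poly_Mapping.lookup x q) (q + i) w)"
  unfolding shifted_modes_def
  using sum_keys_superset[OF assms, of "\<lambda>q v. YW v (q + i) w"] by simp

lemma shifted_modes_zero [simp]: "shifted_modes YW i 0 w = 0"
  by (simp add: shifted_modes_def)

lemma shifted_modes_single [simp]:
  "shifted_modes YW i (Poly_Mapping.single q v) w = YW v (q + i) w"
  unfolding shifted_modes_def by (rule sum_keys_single) simp

lemma shifted_modes_add:
  "shifted_modes YW i (x + y) w = shifted_modes YW i x w + shifted_modes YW i y w"
proof -
  let ?A = "Poly_Mapping.keys x \<union> Poly_Mapping.keys y"
  have "Poly_Mapping.keys (x + y) \<subseteq> ?A" by (rule Poly_Mapping.keys_add)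
  then show ?thesis
    by (simp add: shifted_modes_superset[of ?A] lookup_add sum.distrib)
qed

lemma shifted_modes_sum:
  "shifted_modes YW i (\<Sum>a\<in>A. f a) w = (\<Sum>a\<in>A. shifted_modes YW i (f a) w)"
  by (induction A rule: infinite_finite_induct) (simp_all add: shifted_modes_add)

lemma linear_shifted_modes: "Vector_Spaces.linear sW sW (shifted_modes YW i x)"
  unfolding shifted_modes_def
  by (auto simp: Vector_Spaces.linear_iff W.vector_space_axioms sum.distrib W.scale_sum_right)

end

section \<open>Products of monomials in a twisted loop algebra\<close>

lemma laurent_deriv_single:
  "laurent_deriv (Poly_Mapping.single p c) = Poly_Mapping.single (p - 1) (of_rat p * c)"
  by (simp add: laurent_deriv_def)

lemma laurent_embed_single:
  "laurent_embed (Poly_Mapping.single n c) = Poly_Mapping.single (of_int n) c"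
  by (simp add: laurent_embed_def)

text \<open>
  The divided power \<open>D\<^sup>j / j!\<close> multiplies \<open>t\<^sup>p\<close> by \<open>(p choose j)\<close>: this is where the binomial coefficient
  on the right of the identity in modes comes from.
\<close>

lemma laurent_deriv_power_single:
  "(laurent_deriv ^^ j) (Poly_Mapping.single p 1)
    = Poly_Mapping.single (p - of_nat j) (fact j * (of_rat p gchoose j) :: 'k::field_char_0)"
proof (induction j)
  case (Suc j)
  have "fact (Suc j) * (of_rat p gchoose Suc j)
      = of_rat (p - of_nat j) * (fact j * (of_rat p gchoose j) :: 'k)"
  proof -
    have "of_nat (Suc j) * (of_rat p gchoose Suc j) = (of_rat p - of_nat j) * (of_rat p gchoose j :: 'k)"
      by (simp only: gbinomial_absorption gbinomial_absorb_comp)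
    then show ?thesis
      by (simp only: fact_Suc of_rat_diff of_rat_of_nat_eq mult.assoc mult.left_commute[of _ "fact j"])
  qed
  then show ?case
    by (simp add: Suc laurent_deriv_single algebra_simps)
qed simp

text \<open>The summands of the \<open>n\<close>-th product of \<open>u t\<^sup>p\<close> and \<open>v t\<^sup>q\<close>.\<close>

definition loop_term ::
  "('k::field_char_0 \<Rightarrow> 'v::zero \<Rightarrow> 'v) \<Rightarrow> ('v \<Rightarrow> int \<Rightarrow> 'v \<Rightarrow> 'v) \<Rightarrow>
    int \<Rightarrow> rat \<Rightarrow> 'v \<Rightarrow> rat \<Rightarrow> 'v \<Rightarrow> nat \<Rightarrow> (rat \<Rightarrow>\<^sub>0 'v)" where
  "loop_term s Y n p u q v j = Poly_Mapping.single (p + q - of_nat j)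
    (s (of_rat p gchoose j) (Y u (n + int j) v))"

context vertex_algebra
begin

lemma tensor_single:
  "tensor scale v (Poly_Mapping.single n c) = Poly_Mapping.single n (scale c v)"
  by (simp add: tensor_def map_single)

lemmas product_left_simps [simp] = linearD(1-3)[OF linear_state]
lemmas product_right_simps [simp] = linearD(1-3)[OF linear_mode]

lemma loop_product_eq:
  "loop_product scale Y n x y = (\<Sum>p\<in>Poly_Mapping.keys x. \<Sum>q\<in>Poly_Mapping.keys y.
    Sum_any (loop_term scale Y n p (Poly_Mapping.lookup x p) q (Poly_Mapping.lookup y q)))"
  unfolding loop_product_def
  by (simp add: laurent_deriv_power_single mult_single tensor_single loop_term_def[abs_def] algebra_simps)

lemma loop_product_single_left:
  "loop_product scale Y n (Poly_Mapping.single p u) y = (\<Sum>q\<in>Poly_Mapping.keys y.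
    Sum_any (loop_term scale Y n p u q (Poly_Mapping.lookup y q)))"
  unfolding loop_product_eq
  by (rule sum_keys_single[where f = "\<lambda>p u. \<Sum>q\<in>Poly_Mapping.keys y.
        Sum_any (loop_term scale Y n p u q (Poly_Mapping.lookup y q))"]) (simp add: loop_term_def[abs_def])

lemma loop_product_single_single:
  "loop_product scale Y n (Poly_Mapping.single p u) (Poly_Mapping.single q v)
    = Sum_any (loop_term scale Y n p u q v)"
  unfolding loop_product_single_left
  by (rule sum_keys_single[where f = "\<lambda>q v. Sum_any (loop_term scale Y n p u q v)"])
    (simp add: loop_term_def[abs_def])

lemma loop_term_sum_eventually:
  "\<forall>\<^sub>F N in sequentially. Sum_any (loop_term scale Y n p u q v) = (\<Sum>j<N. loop_term scale Y n p u q v j)"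
  using regularity_eventually_nat[OF regularity[of u v], of n]
  by (intro Sum_any_eventually_lessThan) (auto elim!: eventually_mono simp: loop_term_def)

text \<open>
  Since \<open>vac\<^sub>n = 0\<close> unless \<open>n = -1\<close>, only the summand \<open>j = 0\<close> of the \<open>(-1)\<close>-st product with \<open>vac \<otimes> c t\<^sup>i\<close>
  survives.
\<close>

lemma R_smult_single:
  "R_smult (twisted_loop scale vac Y M \<zeta> g) (Poly_Mapping.single i c) x
    = (\<Sum>q\<in>Poly_Mapping.keys x. Poly_Mapping.single (q + of_int i) (scale c (Poly_Mapping.lookup x q)))"
proof -
  have "loop_term scale Y (-1) (of_int i) (scale c vac) q v
      = (\<lambda>j. if j = 0 then Poly_Mapping.single (q + of_int i) (scale c v) else 0)" for q v
    by (auto simp: loop_term_def fun_eq_iff vacuum add.commute)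
  then have "Sum_any (loop_term scale Y (-1) (of_int i) (scale c vac) q v)
      = Poly_Mapping.single (q + of_int i) (scale c v)" for q v
    by simp
  then show ?thesis
    by (simp add: R_smult_def twisted_loop_def laurent_embed_single tensor_single loop_product_single_left)
qed

lemma R_smult_single_single:
  "R_smult (twisted_loop scale vac Y M \<zeta> g) (Poly_Mapping.single i c) (Poly_Mapping.single q v)
    = Poly_Mapping.single (q + of_int i) (scale c v)"
  unfolding R_smult_single by (rule sum_keys_single) simp

end

section \<open>Eigenspace decomposition\<close>

lemma primitive_root_eq_iff:
  assumes "primitive_root_of_unity M \<zeta>" and "i < M" and "j < M"
  shows "\<zeta> ^ i = (\<zeta> ^ j :: 'k::field) \<longleftrightarrow> i = j"
proof -
  have "\<zeta> ^ i \<noteq> \<zeta> ^ j" if ij: "i < j" "j < M" for i j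
  proof
    assume eq: "\<zeta> ^ i = \<zeta> ^ j"
    have "\<zeta> \<noteq> 0"
      using assms(1) ij by (auto simp: primitive_root_of_unity_def power_0_left)
    then have "\<zeta> ^ (j - i) = 1"
      using eq ij by (simp add: power_diff)
    then show False
      using assms(1) ij by (auto simp: primitive_root_of_unity_def)
  qed
  then show ?thesis
    using assms(2,3) by (metis linorder_neqE_nat)
qed

lemma sum_powers_root_of_unity:
  assumes "x ^ M = (1 :: 'k::field)"
  shows "(\<Sum>i<M. x ^ i) = (if x = 1 then of_nat M else 0)"
  using assms by (simp add: geometric_sum)

locale finite_order_operator = vector_space s
  for s :: "'k::field_char_0 \<Rightarrow> 'v::ab_group_add \<Rightarrow> 'v" +
  fixes g :: "'v \<Rightarrow> 'v" and M :: nat and \<zeta> :: 'k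
  assumes linear: "Vector_Spaces.linear s s g" and M_pos: "M \<ge> 1" and order: "g ^^ M = id"
    and root: "primitive_root_of_unity M \<zeta>"
begin

text \<open>
  The discrete Fourier transform over the cyclic group generated by \<open>g\<close>.
\<close>

definition eigen_projection :: "nat \<Rightarrow> 'v \<Rightarrow> 'v" where
  "eigen_projection r v = s (1 / of_nat M) (\<Sum>i<M. s ((\<zeta> ^ r) ^ i) ((g ^^ i) v))"

lemma root_power: "\<zeta> ^ M = 1" and root_nonzero: "\<zeta> \<noteq> 0"
  using root M_pos by (auto simp: primitive_root_of_unity_def power_0_left)

lemma linear_iterate: "Vector_Spaces.linear s s (g ^^ i)"
proof (induction i)
  case 0
  then show ?case using vector_space_axioms by (simp add: Vector_Spaces.linear_iff)
next
  case (Suc i)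
  then show ?case using linear by (simp add: Vector_Spaces.linear_iff)
qed

lemma linear_eigen_projection: "Vector_Spaces.linear s s (eigen_projection r)"
  unfolding Vector_Spaces.linear_iff eigen_projection_def linearD(2,3)[OF linear_iterate]
    scale_right_distrib sum.distrib scale_sum_right
  by (simp add: vector_space_axioms mult.commute)

text \<open>
  Applying \<open>\<zeta>\<^sup>r g\<close> shifts the summation index cyclically, because \<open>(\<zeta>\<^sup>r)\<^sup>M = 1\<close> and \<open>g\<^sup>M = id\<close>.
\<close>

lemma eigen_projection_in_eigenspace: "eigen_projection r v \<in> eigenspace s \<zeta> g r"
proof -
  define f where "f i = s ((\<zeta> ^ r) ^ i) ((g ^^ i) v)" for i
  have "f M = f 0"
    by (simp add: f_def order root_power flip: power_mult) (simp add: power_mult mult.commute[of r] root_power)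
  then have shift: "(\<Sum>i<M. f (Suc i)) = (\<Sum>i<M. f i)"
    using sum.lessThan_Suc_shift[of f M] sum.lessThan_Suc[of f M] by simp
  have "s (\<zeta> ^ r) (g (eigen_projection r v)) = s (1 / of_nat M) (\<Sum>i<M. f (Suc i))"
    by (simp add: eigen_projection_def f_def linearD[OF linear] scale_sum_right mult.commute mult.left_commute)
  also have "\<dots> = eigen_projection r v"
    unfolding shift by (simp add: eigen_projection_def f_def)
  finally have "s (inverse (\<zeta> ^ r)) (s (\<zeta> ^ r) (g (eigen_projection r v)))
      = s (inverse (\<zeta> ^ r)) (eigen_projection r v)" by simp
  then show ?thesis
    by (simp add: eigenspace_def power_int_minus root_nonzero)
qed

text \<open>
  After exchanging the sums, the coefficient of \<open>g\<^sup>i v\<close> is a sum over all powers of the root of unity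
  \<open>\<zeta>\<^sup>i\<close>, which vanishes unless \<open>i = 0\<close>.
\<close>

lemma sum_eigen_projection: "(\<Sum>r<M. eigen_projection r v) = v"
proof -
  have "(\<Sum>r<M. (\<zeta> ^ i) ^ r) = (if i = 0 then of_nat M else 0 :: 'k)" if "i < M" for i
  proof -
    have "(\<zeta> ^ i) ^ M = 1" by (metis root_power power_mult mult.commute power_one)
    moreover have "\<zeta> ^ i = 1 \<longleftrightarrow> i = 0"
      using primitive_root_eq_iff[OF root that, of 0] M_pos by simp
    ultimately show ?thesis by (simp add: sum_powers_root_of_unity)
  qed
  note root_sum = this
  have "(\<Sum>r<M. eigen_projection r v)
      = s (1 / of_nat M) (\<Sum>i<M. \<Sum>r<M. s ((\<zeta> ^ r) ^ i) ((g ^^ i) v))"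
    unfolding eigen_projection_def scale_sum_right[symmetric] by (subst sum.swap) (rule refl)
  also have "\<dots> = s (1 / of_nat M) (\<Sum>i<M. s (\<Sum>r<M. (\<zeta> ^ i) ^ r) ((g ^^ i) v))"
    by (simp add: scale_sum_left mult.commute flip: power_mult)
  also have "\<dots> = s (1 / of_nat M) (\<Sum>i<M. if i = 0 then s (of_nat M) v else 0)"
    by (intro arg_cong[where f = "s _"] sum.cong) (auto simp: root_sum)
  also have "\<dots> = v" using M_pos by simp
  finally show ?thesis .
qed

lemma eigen_projection_on_eigenspace:
  assumes v: "v \<in> eigenspace s \<zeta> g t" and "t < M" and "r < M"
  shows "eigen_projection r v = (if r = t then v else 0)"
proof -
  have gv: "g v = s (inverse (\<zeta> ^ t)) v"
    using v by (simp add: eigenspace_def power_int_minus)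
  have iter: "(g ^^ i) v = s (inverse (\<zeta> ^ t) ^ i) v" for i
    by (induction i) (simp_all add: linearD[OF linear] gv mult.commute)
  define x where "x = \<zeta> ^ r * inverse (\<zeta> ^ t)"
  have "x ^ M = 1"
    by (simp add: x_def power_mult_distrib power_inverse)
      (metis mult.commute power_mult power_one root_power inverse_1 mult_1)
  moreover have "x = 1 \<longleftrightarrow> r = t"
    using primitive_root_eq_iff[OF root \<open>r < M\<close> \<open>t < M\<close>] root_nonzero
    by (auto simp: x_def field_simps)
  ultimately have "(\<Sum>i<M. x ^ i) = (if r = t then of_nat M else 0)"
    by (simp add: sum_powers_root_of_unity)
  moreover have "eigen_projection r v = s (1 / of_nat M * (\<Sum>i<M. x ^ i)) v"
    by (simp add: eigen_projection_def iter x_def power_mult_distrib flip: scale_sum_left)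
  ultimately show ?thesis using M_pos by auto
qed

lemma eigenspace_induct:
  assumes "\<And>r v. r < M \<Longrightarrow> v \<in> eigenspace s \<zeta> g r \<Longrightarrow> P v"
    and "P 0" and "\<And>u v. P u \<Longrightarrow> P v \<Longrightarrow> P (u + v)"
  shows "P v"
proof -
  have "P (\<Sum>r\<in>A. eigen_projection r v)" if "A \<subseteq> {..<M}" for A
    using finite_subset[OF that finite_lessThan] that
    by (induction A rule: finite_induct)
      (auto intro: assms eigen_projection_in_eigenspace)
  from this[of "{..<M}"] show ?thesis by (simp add: sum_eigen_projection)
qed

end

section \<open>Cosets and products of eigenvectors\<close>

lemma Ints_add_iff: "a \<in> \<int> \<Longrightarrow> a + b \<in> \<int> \<longleftrightarrow> (b :: 'a::ring_1) \<in> \<int>"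
  using Ints_diff[of "a + b" a] by auto

lemma in_coset_add_int:
  assumes "i \<in> \<int>"
  shows "in_coset M r (n + i) \<longleftrightarrow> in_coset M r n"
  using Ints_add_iff[OF assms, of "n - of_nat r / of_nat M"] by (simp add: in_coset_def algebra_simps)

text \<open>
  Exponents and eigenvalues are graded compatibly; reducing \<open>r + t\<close> modulo \<open>M\<close> changes
  \<open>(r + t) / M\<close> by an integer.
\<close>

lemma in_coset_add:
  assumes "M \<ge> 1" and "in_coset M r m"
  shows "in_coset M ((r + t) mod M) (m + n) \<longleftrightarrow> in_coset M t n"
proof -
  have "(of_nat (r + t) :: rat) = of_nat ((r + t) div M) * of_nat M + of_nat ((r + t) mod M)"
    by (metis div_mult_mod_eq of_nat_add of_nat_mult)
  then have "(of_nat (r + t) / of_nat M :: rat)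
      = of_nat ((r + t) div M) + of_nat ((r + t) mod M) / of_nat M"
    using assms(1) by (simp only: add_divide_distrib) simp
  then have "m + n - of_nat ((r + t) mod M) / of_nat M
      = (m - of_nat r / of_nat M + of_nat ((r + t) div M)) + (n - of_nat t / of_nat M)"
    by (simp add: add_divide_distrib)
  moreover have "m - of_nat r / of_nat M + of_nat ((r + t) div M) \<in> \<int>"
    using assms(2) by (auto simp: in_coset_def)
  ultimately show ?thesis
    unfolding in_coset_def by (simp only: Ints_add_iff)
qed

text \<open>
  The exponent determines the eigenspace, since \<open>(r - t) / M\<close> is an integer of absolute value less
  than \<open>1\<close>. This makes the carrier of a twisted loop algebra closed under addition.
\<close>

lemma in_coset_unique:
  assumes "r < M" "t < M" "in_coset M r n" "in_coset M t n"
  shows "r = t"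
proof -
  have "(n - of_nat t / of_nat M) - (n - of_nat r / of_nat M) \<in> \<int>"
    using assms(3,4) unfolding in_coset_def by (rule Ints_diff[rotated])
  then obtain i :: int where "(n - of_nat t / of_nat M) - (n - of_nat r / of_nat M) = of_int i"
    by (auto elim: Ints_cases)
  then have "(of_nat r - of_nat t) / of_nat M = (of_int i :: rat)"
    by (simp add: diff_divide_distrib)
  then have "(of_int (int r - int t) :: rat) = of_int (i * int M)"
    using assms(1) by (simp add: divide_eq_eq)
  then have i: "int r - int t = i * int M"
    by (simp only: of_int_eq_iff)
  have "\<bar>i * int M\<bar> < int M"
    using assms(1,2) unfolding i[symmetric] by linarith
  then have "i = 0"
    using assms(1) by (simp add: abs_mult)
  then show ?thesis using i by simp
qed

lemma (in vertex_algebra) eigenspace_product: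
  assumes g: "va_automorphism scale vac Y g" and root: "\<zeta> ^ M = 1" "\<zeta> \<noteq> 0"
    and u: "u \<in> eigenspace scale \<zeta> g r" and v: "v \<in> eigenspace scale \<zeta> g t"
  shows "Y u n v \<in> eigenspace scale \<zeta> g ((r + t) mod M)"
proof -
  have "\<zeta> ^ (r + t) = \<zeta> ^ ((r + t) div M * M + (r + t) mod M)" by simp
  also have "\<dots> = \<zeta> ^ ((r + t) mod M)"
    by (simp only: power_add mult.commute[of _ M] power_mult root power_one mult_1)
  finally show ?thesis
    using g u v
    by (simp add: va_automorphism_def eigenspace_def power_int_minus power_add)
      (simp add: mult.commute flip: inverse_mult_distrib)
qed

lemma (in vertex_algebra) borcherds_identity_add:
  assumes "field_map scale sW M YW"
    and "borcherds_identity sW Y YW u v w l m n" and "borcherds_identity sW Y YW u v' w l m n"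
  shows "borcherds_identity sW Y YW u (v + v') w l m n"
proof -
  interpret field_map scale sW M YW by fact
  have add: "product_term sW YW u (v + v') w l m n j
      = product_term sW YW u v w l m n j + product_term sW YW u v' w l m n j"
    "product_term sW YW (v + v') u w l n m j
      = product_term sW YW v u w l n m j + product_term sW YW v' u w l n m j"
    "iterate_term sW Y YW u (v + v') w l m n j
      = iterate_term sW Y YW u v w l m n j + iterate_term sW Y YW u v' w l m n j" for j
    by (simp_all add: product_term_def iterate_term_def W.scale_right_distrib)
  show ?thesis
    using assms(2,3) unfolding borcherds_identity_def add sum.distrib
    by eventually_elim (simp add: W.scale_right_distrib algebra_simps)
qed

section \<open>The Borcherds identity on the twisted loop algebra\<close>

locale twisted_module = VA: vertex_algebra sV vac Y
  for sV :: "'k::field_char_0 \<Rightarrow> 'v::ab_group_add \<Rightarrow> 'v"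
    and vac :: 'v and Y :: "'v \<Rightarrow> int \<Rightarrow> 'v \<Rightarrow> 'v" +
  fixes h :: "'v \<Rightarrow> 'v" and M :: nat and \<zeta> :: 'k
    and sW :: "'k \<Rightarrow> 'w::ab_group_add \<Rightarrow> 'w"
    and YW :: "'v \<Rightarrow> rat \<Rightarrow> 'w \<Rightarrow> 'w"
  assumes weak: "weak_twisted_module sV vac Y M \<zeta> h sW YW"
begin

abbreviation "Lh \<equiv> twisted_loop sV vac Y M \<zeta> h"

sublocale F: field_map sV sW M YW
  using weak by (intro field_map.intro field_map_axioms.intro VA.vector_space_axioms)
    (auto simp: weak_twisted_module_def)

lemma truncation_homogeneous:
  assumes "r < M" and "v \<in> eigenspace sV \<zeta> h r"
  shows "\<exists>N. \<forall>n\<ge>N. YW v n w = 0"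
  using weak assms by (auto simp: weak_twisted_module_def)

lemma borcherds_homogeneous:
  assumes u: "r < M" "u \<in> eigenspace sV \<zeta> h r" and v: "t < M" "v \<in> eigenspace sV \<zeta> h t"
    and m: "in_coset M r m"
  shows "borcherds_identity sW Y YW u v w l m n"
proof -
  have "twisted_jacobi sW Y YW (of_nat r / of_nat M) u v w"
    using weak u by (auto simp: weak_twisted_module_def)
  moreover have "YW u n = (\<lambda>_. 0)" if "n - of_nat r / of_nat M \<notin> \<int>" for n
    using weak u that by (auto simp: weak_twisted_module_def in_coset_def)
  ultimately show ?thesis
    using twisted_jacobi_iff_borcherds_identity[of sW "of_nat r / of_nat M" YW u v w Y]
      F.W.vector_space_axioms truncation_homogeneous[OF u] truncation_homogeneous[OF v]
      VA.regularity[of u v] m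
    by (simp add: in_coset_def)
qed

lemma carrier_keyE:
  assumes "x \<in> va_carrier Lh" and "q \<in> Poly_Mapping.keys x"
  obtains r where "r < M" "in_coset M r q" "Poly_Mapping.lookup x q \<in> eigenspace sV \<zeta> h r"
  using assms by (auto simp: twisted_loop_def)

lemma truncation_shifted_modes:
  assumes "x \<in> va_carrier Lh"
  shows "\<exists>N. \<forall>i\<ge>N. shifted_modes YW i x w = 0"
proof -
  have "\<forall>\<^sub>F i in at_top. YW (Poly_Mapping.lookup x q) (q + i) w = 0"
    if q: "q \<in> Poly_Mapping.keys x" for q
  proof -
    obtain r where "r < M" "Poly_Mapping.lookup x q \<in> eigenspace sV \<zeta> h r"
      using assms q by (rule carrier_keyE)
    from truncation_homogeneous[OF this]
    obtain N where "\<And>n. n \<ge> N \<Longrightarrow> YW (Poly_Mapping.lookup x q) n w = 0" by blast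
    then have "YW (Poly_Mapping.lookup x q) (q + i) w = 0" if "i \<ge> N - q" for i
      using that by (simp add: diff_le_eq add.commute)
    then show ?thesis by (auto simp: eventually_at_top_linorder)
  qed
  then have "\<forall>\<^sub>F i in at_top. \<forall>q\<in>Poly_Mapping.keys x. YW (Poly_Mapping.lookup x q) (q + i) w = 0"
    by (intro eventually_ball_finite) auto
  then have "\<forall>\<^sub>F i in at_top. shifted_modes YW i x w = 0"
    by (rule eventually_mono) (simp add: shifted_modes_def)
  then show ?thesis by (simp add: eventually_at_top_linorder)
qed

text \<open>
  The identity that transports along homomorphisms. Expanding \<open>x\<close> and \<open>y\<close> into monomials
  \<open>x\<^sub>p t\<^sup>p\<close>, \<open>y\<^sub>q t\<^sup>q\<close>, it is the sum over all \<open>(p, q)\<close> of the identity in modes for \<open>m = p\<close>, \<open>n = q\<close>; each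
  \<open>p\<close> lies in the coset required there by definition of the loop algebra.
\<close>

lemma loop_borcherds:
  assumes x: "x \<in> va_carrier Lh" and y: "y \<in> va_carrier Lh"
  shows "\<forall>\<^sub>F N in sequentially.
    (\<Sum>j<N. sW ((-1) ^ j * (of_int l gchoose j))
        (shifted_modes YW (of_int l - of_nat j) x (shifted_modes YW (of_nat j) y w)))
      - sW ((-1) powi l) (\<Sum>j<N. sW ((-1) ^ j * (of_int l gchoose j))
        (shifted_modes YW (of_int l - of_nat j) y (shifted_modes YW (of_nat j) x w)))
    = mode_map YW (va_product Lh l x y) w"
proof -
  let ?X = "Poly_Mapping.lookup x" and ?Y = "Poly_Mapping.lookup y"
  let ?K = "Poly_Mapping.keys x" and ?J = "Poly_Mapping.keys y"
  have expand: "(\<Sum>j<N. sW ((-1) ^ j * (of_int l gchoose j))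
        (shifted_modes YW (of_int l - of_nat j) a (shifted_modes YW (of_nat j) b w)))
      = (\<Sum>p\<in>Poly_Mapping.keys a. \<Sum>q\<in>Poly_Mapping.keys b. \<Sum>j<N.
          product_term sW YW (Poly_Mapping.lookup a p) (Poly_Mapping.lookup b q) w l p q j)" for N a b
  proof -
    have "sW ((-1) ^ j * (of_int l gchoose j))
        (shifted_modes YW (of_int l - of_nat j) a (shifted_modes YW (of_nat j) b w))
      = (\<Sum>p\<in>Poly_Mapping.keys a. \<Sum>q\<in>Poly_Mapping.keys b.
          product_term sW YW (Poly_Mapping.lookup a p) (Poly_Mapping.lookup b q) w l p q j)" for j
      by (simp add: shifted_modes_def F.mode_sum F.W.scale_sum_right product_term_def add_diff_eq)
    then show ?thesis
      by (simp add: sum.swap[of _ "{..<N}"])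
  qed
  have loop: "\<forall>\<^sub>F N in sequentially. \<forall>p\<in>?K. \<forall>q\<in>?J.
      mode_map YW (Sum_any (loop_term sV Y l p (?X p) q (?Y q))) w
        = (\<Sum>j<N. iterate_term sW Y YW (?X p) (?Y q) w l p q j)"
  proof (intro eventually_ball_finite ballI finite_keys)
    fix p q
    show "\<forall>\<^sub>F N in sequentially.
      mode_map YW (Sum_any (loop_term sV Y l p (?X p) q (?Y q))) w
        = (\<Sum>j<N. iterate_term sW Y YW (?X p) (?Y q) w l p q j)"
      using VA.loop_term_sum_eventually[of l p "?X p" q "?Y q"]
    proof eventually_elim
      case (elim N)
      then show ?case
        by (simp add: mode_map_eq_shifted_modes F.shifted_modes_sum loop_term_def iterate_term_def)
    qed
  qed
  have "\<forall>\<^sub>F N in sequentially. \<forall>p\<in>?K. \<forall>q\<in>?J.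
      (\<Sum>j<N. product_term sW YW (?X p) (?Y q) w l p q j)
        - sW ((-1) powi l) (\<Sum>j<N. product_term sW YW (?Y q) (?X p) w l q p j)
      = (\<Sum>j<N. iterate_term sW Y YW (?X p) (?Y q) w l p q j)"
  proof (intro eventually_ball_finite ballI finite_keys)
    fix p q assume p: "p \<in> ?K" and q: "q \<in> ?J"
    obtain r where "r < M" "in_coset M r p" "?X p \<in> eigenspace sV \<zeta> h r"
      using x p by (rule carrier_keyE)
    moreover obtain t where "t < M" "?Y q \<in> eigenspace sV \<zeta> h t"
      using y q by (rule carrier_keyE)
    ultimately have "borcherds_identity sW Y YW (?X p) (?Y q) w l p q"
      by (intro borcherds_homogeneous)
    then show "\<forall>\<^sub>F N in sequentially.
      (\<Sum>j<N. product_term sW YW (?X p) (?Y q) w l p q j)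
        - sW ((-1) powi l) (\<Sum>j<N. product_term sW YW (?Y q) (?X p) w l q p j)
      = (\<Sum>j<N. iterate_term sW Y YW (?X p) (?Y q) w l p q j)"
      by (simp add: borcherds_identity_def)
  qed
  then show ?thesis
    using loop
  proof eventually_elim
    case (elim N)
    have "mode_map YW (va_product Lh l x y) w
        = (\<Sum>p\<in>?K. \<Sum>q\<in>?J. mode_map YW (Sum_any (loop_term sV Y l p (?X p) q (?Y q))) w)"
      by (simp add: twisted_loop_def VA.loop_product_eq mode_map_eq_shifted_modes F.shifted_modes_sum)
    also have "\<dots> = (\<Sum>p\<in>?K. \<Sum>q\<in>?J.
        (\<Sum>j<N. product_term sW YW (?X p) (?Y q) w l p q j)
        - sW ((-1) powi l) (\<Sum>j<N. product_term sW YW (?Y q) (?X p) w l q p j))"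
      using elim by (intro sum.cong) auto
    also have "\<dots> = (\<Sum>p\<in>?K. \<Sum>q\<in>?J. \<Sum>j<N. product_term sW YW (?X p) (?Y q) w l p q j)
        - sW ((-1) powi l) (\<Sum>q\<in>?J. \<Sum>p\<in>?K. \<Sum>j<N. product_term sW YW (?Y q) (?X p) w l q p j)"
      unfolding sum.swap[of _ ?K ?J] sum_subtractf F.W.scale_sum_right ..
    finally show ?case
      unfolding expand by simp
  qed
qed

end

section \<open>Homomorphisms of twisted loop algebras\<close>

locale loop_homomorphism =
  twisted_module sV vac Y h M \<zeta> sW YW + G: finite_order_operator sV g M \<zeta>
  for sV :: "'k::field_char_0 \<Rightarrow> 'v::ab_group_add \<Rightarrow> 'v"
    and vac :: 'v and Y :: "'v \<Rightarrow> int \<Rightarrow> 'v \<Rightarrow> 'v" and h :: "'v \<Rightarrow> 'v" and M :: nat and \<zeta> :: 'k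
    and sW :: "'k \<Rightarrow> 'w::ab_group_add \<Rightarrow> 'w" and YW :: "'v \<Rightarrow> rat \<Rightarrow> 'w \<Rightarrow> 'w"
    and g :: "'v \<Rightarrow> 'v" +
  fixes \<phi> :: "(rat \<Rightarrow>\<^sub>0 'v) \<Rightarrow> (rat \<Rightarrow>\<^sub>0 'v)"
  assumes aut: "va_automorphism sV vac Y g"
    and hom: "R_vertex_algebra_hom (twisted_loop sV vac Y M \<zeta> g) (twisted_loop sV vac Y M \<zeta> h) \<phi>"
begin

abbreviation "Lg \<equiv> twisted_loop sV vac Y M \<zeta> g"

lemma hom_closed: "x \<in> va_carrier Lg \<Longrightarrow> \<phi> x \<in> va_carrier Lh"
  and hom_add: "x \<in> va_carrier Lg \<Longrightarrow> y \<in> va_carrier Lg \<Longrightarrow> \<phi> (x + y) = \<phi> x + \<phi> y"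
  and hom_smult: "x \<in> va_carrier Lg \<Longrightarrow> \<phi> (R_smult Lg a x) = R_smult Lh a (\<phi> x)"
  and hom_product: "x \<in> va_carrier Lg \<Longrightarrow> y \<in> va_carrier Lg \<Longrightarrow>
    \<phi> (va_product Lg n x y) = va_product Lh n (\<phi> x) (\<phi> y)"
  and hom_vacuum: "\<phi> (va_vacuum Lg) = va_vacuum Lh"
  using hom by (auto simp: R_vertex_algebra_hom_def)

lemma eigenspace_add:
  "u \<in> eigenspace sV \<zeta> g r \<Longrightarrow> v \<in> eigenspace sV \<zeta> g r \<Longrightarrow> u + v \<in> eigenspace sV \<zeta> g r"
  and eigenspace_scale: "v \<in> eigenspace sV \<zeta> g r \<Longrightarrow> sV c v \<in> eigenspace sV \<zeta> g r"
  by (simp_all add: eigenspace_def linearD[OF G.linear] VA.scale_right_distrib mult.commute)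

lemma carrier_zero: "0 \<in> va_carrier Lg"
  by (simp add: twisted_loop_def)

lemma carrier_single:
  assumes "r < M" "in_coset M r n" "v \<in> eigenspace sV \<zeta> g r"
  shows "Poly_Mapping.single n v \<in> va_carrier Lg"
  using assms by (auto simp: twisted_loop_def split: if_splits)

lemma carrier_add:
  assumes "x \<in> va_carrier Lg" "y \<in> va_carrier Lg"
  shows "x + y \<in> va_carrier Lg"
proof -
  have "\<exists>r<M. in_coset M r n \<and> Poly_Mapping.lookup (x + y) n \<in> eigenspace sV \<zeta> g r"
    if "n \<in> Poly_Mapping.keys (x + y)" for n
  proof -
    have ex: "\<exists>r<M. in_coset M r n \<and> Poly_Mapping.lookup z n \<in> eigenspace sV \<zeta> g r"
      if "z \<in> va_carrier Lg" "n \<in> Poly_Mapping.keys z" for z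
      using that by (auto simp: twisted_loop_def)
    show ?thesis
    proof (cases "n \<in> Poly_Mapping.keys x"; cases "n \<in> Poly_Mapping.keys y")
      assume "n \<in> Poly_Mapping.keys x" "n \<in> Poly_Mapping.keys y"
      with ex[OF assms(1)] ex[OF assms(2)] show ?thesis
        by (metis in_coset_unique lookup_add eigenspace_add)
    next
      assume "n \<in> Poly_Mapping.keys x" "n \<notin> Poly_Mapping.keys y"
      with ex[OF assms(1)] show ?thesis by (simp add: lookup_add in_keys_iff)
    next
      assume "n \<notin> Poly_Mapping.keys x" "n \<in> Poly_Mapping.keys y"
      with ex[OF assms(2)] show ?thesis by (simp add: lookup_add in_keys_iff)
    next
      assume "n \<notin> Poly_Mapping.keys x" "n \<notin> Poly_Mapping.keys y"
      with that show ?thesis by (simp add: lookup_add in_keys_iff)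
    qed
  qed
  then show ?thesis by (simp add: twisted_loop_def)
qed

lemma hom_zero: "\<phi> 0 = 0"
  using hom_add[OF carrier_zero carrier_zero] by simp

lemma hom_sum:
  assumes "\<And>a. a \<in> A \<Longrightarrow> f a \<in> va_carrier Lg"
  shows "\<phi> (\<Sum>a\<in>A. f a) = (\<Sum>a\<in>A. \<phi> (f a))"
proof -
  have "(\<Sum>a\<in>A. f a) \<in> va_carrier Lg \<and> \<phi> (\<Sum>a\<in>A. f a) = (\<Sum>a\<in>A. \<phi> (f a))"
    using assms
    by (induction A rule: infinite_finite_induct) (auto simp: hom_zero carrier_zero hom_add carrier_add)
  then show ?thesis ..
qed

text \<open>
  Linearity of \<open>\<phi>\<close> over \<open>k[t\<^sup>\<plusminus>\<^sup>1]\<close>, applied to the monomial \<open>c t\<^sup>i\<close>. The case \<open>i = 0\<close> is linearity over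
  \<open>k\<close>, and \<open>c = 1\<close> shifts the modes.
\<close>

lemma mode_map_hom_shift:
  assumes "r < M" "in_coset M r n" "v \<in> eigenspace sV \<zeta> g r"
  shows "mode_map YW (\<phi> (Poly_Mapping.single (n + of_int i) (sV c v))) w
    = sW c (shifted_modes YW (of_int i) (\<phi> (Poly_Mapping.single n v)) w)"
proof -
  have "\<phi> (Poly_Mapping.single (n + of_int i) (sV c v))
      = R_smult Lh (Poly_Mapping.single i c) (\<phi> (Poly_Mapping.single n v))"
    using hom_smult[OF carrier_single[OF assms], of "Poly_Mapping.single i c"]
    unfolding VA.R_smult_single_single .
  then show ?thesis
    by (simp add: mode_map_eq_shifted_modes VA.R_smult_single F.shifted_modes_sum
        shifted_modes_def[of YW "of_int i"] F.W.scale_sum_right)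
qed

lemma mode_map_hom_scale:
  assumes "r < M" "in_coset M r n" "v \<in> eigenspace sV \<zeta> g r"
  shows "mode_map YW (\<phi> (Poly_Mapping.single n (sV c v))) w
    = sW c (mode_map YW (\<phi> (Poly_Mapping.single n v)) w)"
  using mode_map_hom_shift[OF assms, of 0 c w] by (simp add: mode_map_eq_shifted_modes)

lemma mode_map_hom_add:
  assumes "r < M" "in_coset M r n" "u \<in> eigenspace sV \<zeta> g r" "v \<in> eigenspace sV \<zeta> g r"
  shows "mode_map YW (\<phi> (Poly_Mapping.single n (u + v))) w
    = mode_map YW (\<phi> (Poly_Mapping.single n u)) w + mode_map YW (\<phi> (Poly_Mapping.single n v)) w"
  using assms by (simp add: single_add hom_add carrier_single mode_map_eq_shifted_modes F.shifted_modes_add)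

section \<open>Existence and uniqueness of the pullback\<close>

text \<open>
  The linear extension from the eigenspaces: each component of \<open>v\<close> contributes through its own
  exponents.
\<close>

definition pullback :: "'v \<Rightarrow> rat \<Rightarrow> 'w \<Rightarrow> 'w" where
  "pullback v n w = (\<Sum>r<M. if in_coset M r n
    then mode_map YW (\<phi> (Poly_Mapping.single n (G.eigen_projection r v))) w else 0)"

lemma is_pullback_pullback: "is_pullback sV M \<zeta> g sW \<phi> YW pullback"
proof -
  note proj = G.eigen_projection_in_eigenspace
  have "Vector_Spaces.linear sV sW (\<lambda>v. pullback v n w)" for n w
  proof -
    have "pullback (u + v) n w = pullback u n w + pullback v n w" for u v
      unfolding pullback_def sum.distrib[symmetric]
      by (intro sum.cong)
        (auto simp: linearD[OF G.linear_eigen_projection] intro: mode_map_hom_add[OF _ _ proj proj])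
    moreover have "pullback (sV c v) n w = sW c (pullback v n w)" for c v
      unfolding pullback_def F.W.scale_sum_right
      by (intro sum.cong)
        (auto simp: linearD[OF G.linear_eigen_projection] intro: mode_map_hom_scale[OF _ _ proj])
    ultimately show ?thesis
      by (simp add: Vector_Spaces.linear_iff VA.vector_space_axioms F.W.vector_space_axioms)
  qed
  moreover have "Vector_Spaces.linear sW sW (pullback v n)" for v n
    by (simp add: Vector_Spaces.linear_iff F.W.vector_space_axioms pullback_def mode_map_eq_shifted_modes
        linearD[OF F.linear_shifted_modes] F.W.scale_sum_right if_distrib[of "sW _"] cong: if_cong
        flip: sum.distrib) (auto intro: sum.cong)
  moreover have "pullback v n = (\<lambda>_. 0)" if "of_nat M * n \<notin> \<int>" for v n
  proof -
    have "\<not> in_coset M r n" for r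
    proof
      assume "in_coset M r n"
      then have "of_nat M * (n - of_nat r / of_nat M) + of_nat r \<in> (\<int> :: rat set)"
        unfolding in_coset_def by (intro Ints_add Ints_mult) auto
      then show False
        using that G.M_pos by (simp add: right_diff_distrib)
    qed
    then show ?thesis by (simp add: pullback_def fun_eq_iff)
  qed
  moreover have "pullback v n
      = (if in_coset M r n then mode_map YW (\<phi> (Poly_Mapping.single n v)) else (\<lambda>_. 0))"
    if "r < M" "v \<in> eigenspace sV \<zeta> g r" for r v n
  proof
    fix w
    have "pullback v n w = (\<Sum>t<M. if t = r then (if in_coset M r n
        then mode_map YW (\<phi> (Poly_Mapping.single n v)) w else 0) else 0)"
      unfolding pullback_def
      by (intro sum.cong) (auto simp: G.eigen_projection_on_eigenspace[OF that(2,1)] hom_zero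
          mode_map_eq_shifted_modes)
    then show "pullback v n w
        = (if in_coset M r n then mode_map YW (\<phi> (Poly_Mapping.single n v)) else (\<lambda>_. 0)) w"
      using that by simp
  qed
  ultimately show ?thesis
    by (simp add: is_pullback_def linear_field_map_def)
qed

sublocale P: field_map sV sW M pullback
  using is_pullback_pullback
  by (intro field_map.intro field_map_axioms.intro VA.vector_space_axioms F.W.vector_space_axioms)
    (simp add: is_pullback_def)

lemma pullback_unique:
  assumes Y': "is_pullback sV M \<zeta> g sW \<phi> YW Y'"
  shows "Y' = pullback"
proof -
  interpret P': field_map sV sW M Y'
    using Y' by unfold_locales (simp add: is_pullback_def)
  have "Y' v n w = pullback v n w" for v n w
  proof (induction v rule: G.eigenspace_induct)
    case (1 r v)
    then show ?case
      using Y' is_pullback_pullback by (simp add: is_pullback_def)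
  qed simp_all
  then show ?thesis by blast
qed

section \<open>The pullback is a twisted module\<close>

lemma pullback_homogeneous:
  assumes "r < M" "v \<in> eigenspace sV \<zeta> g r"
  shows "pullback v n
    = (if in_coset M r n then mode_map YW (\<phi> (Poly_Mapping.single n v)) else (\<lambda>_. 0))"
  using is_pullback_pullback assms by (simp add: is_pullback_def)

lemma pullback_outside_coset:
  assumes "r < M" "v \<in> eigenspace sV \<zeta> g r" "\<not> in_coset M r n"
  shows "pullback v n = (\<lambda>_. 0)"
  using assms by (simp add: pullback_homogeneous)

lemma pullback_shift:
  assumes "r < M" "v \<in> eigenspace sV \<zeta> g r" "in_coset M r n"
  shows "pullback v (n + of_int i) w
    = shifted_modes YW (of_int i) (\<phi> (Poly_Mapping.single n v)) w"
  using mode_map_hom_shift[OF assms(1,3,2), of i 1 w] assms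
  by (simp add: pullback_homogeneous in_coset_add_int)

lemma vacuum_in_eigenspace: "vac \<in> eigenspace sV \<zeta> g 0"
  using aut by (simp add: va_automorphism_def eigenspace_def)

lemma pullback_vacuum: "pullback vac n w = (if n = -1 then w else 0)"
proof (cases "n \<in> \<int>")
  case True
  then obtain i where i: "n = of_int i" by (auto elim: Ints_cases)
  have "pullback vac (0 + of_int i) w
      = shifted_modes YW (of_int i) (\<phi> (Poly_Mapping.single 0 vac)) w"
    using G.M_pos by (intro pullback_shift[of 0] vacuum_in_eigenspace) (auto simp: in_coset_def)
  also have "\<phi> (Poly_Mapping.single 0 vac) = Poly_Mapping.single 0 vac"
    using hom_vacuum by (simp add: twisted_loop_def)
  finally show ?thesis
    using weak by (simp add: i weak_twisted_module_def)
next
  case False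
  then have "n \<noteq> -1" by auto
  with False show ?thesis
    using G.M_pos by (simp add: pullback_homogeneous[OF _ vacuum_in_eigenspace] in_coset_def)
qed

text \<open>
  On an eigenvector, all nonzero modes are shifts of the modes of one element of \<open>L(V, h)\<close>, the image
  of \<open>v \<otimes> t\<^sup>r\<^sup>/\<^sup>M\<close>.
\<close>

lemma truncation_pullback: "\<exists>N. \<forall>n\<ge>N. pullback v n w = 0"
proof (induction v rule: G.eigenspace_induct)
  case (1 r v)
  define q :: rat where "q = of_nat r / of_nat M"
  have q: "in_coset M r q" by (simp add: in_coset_def q_def)
  obtain N where N: "\<And>i. i \<ge> N \<Longrightarrow> shifted_modes YW i (\<phi> (Poly_Mapping.single q v)) w = 0"
    using truncation_shifted_modes[OF hom_closed[OF carrier_single[OF 1(1) q 1(2)]]] by blast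
  have "pullback v n w = 0" if "n \<ge> N + q" for n
  proof (cases "in_coset M r n")
    case True
    then obtain i where i: "n - q = of_int i"
      by (auto simp: in_coset_def q_def elim: Ints_cases)
    have "pullback v (q + of_int i) w = 0"
      unfolding pullback_shift[OF 1 q] using that i by (intro N) linarith
    then show ?thesis by (simp flip: i)
  qed (simp add: pullback_homogeneous[OF 1])
  then show ?case by blast
next
  case (3 u v)
  then obtain N N' where "\<And>n. n \<ge> N \<Longrightarrow> pullback u n w = 0" "\<And>n. n \<ge> N' \<Longrightarrow> pullback v n w = 0"
    by blast
  then show ?case by (intro exI[of _ "max N N'"]) simp
qed simp

lemma eigenspace_product:
  assumes "u \<in> eigenspace sV \<zeta> g r" "v \<in> eigenspace sV \<zeta> g t"
  shows "Y u n v \<in> eigenspace sV \<zeta> g ((r + t) mod M)"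
  using VA.eigenspace_product[OF aut G.root_power G.root_nonzero assms] .

text \<open>
  The identity of \<open>loop_borcherds\<close> for \<open>x = \<phi>(u \<otimes> t\<^sup>m)\<close> and \<open>y = \<phi>(v \<otimes> t\<^sup>n)\<close>: the shifted modes of \<open>x\<close>
  and \<open>y\<close> are modes of the pullback, and since \<open>\<phi>\<close> preserves the \<open>l\<close>-th product, its right-hand side
  is the image of \<open>(u \<otimes> t\<^sup>m)\<^sub>l (v \<otimes> t\<^sup>n)\<close>. If \<open>n\<close> is not an exponent that occurs with \<open>v\<close>, both sides
  of the identity in modes vanish.
\<close>

lemma borcherds_pullback_homogeneous:
  assumes u: "r < M" "u \<in> eigenspace sV \<zeta> g r" and v: "t < M" "v \<in> eigenspace sV \<zeta> g t"
    and m: "in_coset M r m"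
  shows "borcherds_identity sW Y pullback u v w l m n"
proof (cases "in_coset M t n")
  case n: True
  define x where "x = \<phi> (Poly_Mapping.single m u)"
  define y where "y = \<phi> (Poly_Mapping.single n v)"
  note in_L = carrier_single[OF u(1) m u(2)] carrier_single[OF v(1) n v(2)]
  have shift: "pullback u (m + of_int l - of_nat j) w' = shifted_modes YW (of_int l - of_nat j) x w'"
    "pullback u (m + of_nat j) w' = shifted_modes YW (of_nat j) x w'"
    "pullback v (n + of_int l - of_nat j) w' = shifted_modes YW (of_int l - of_nat j) y w'"
    "pullback v (n + of_nat j) w' = shifted_modes YW (of_nat j) y w'" for j w'
    using pullback_shift[OF u m, of "l - int j"] pullback_shift[OF u m, of "int j"]
      pullback_shift[OF v n, of "l - int j"] pullback_shift[OF v n, of "int j"]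
    by (simp_all add: x_def y_def add_diff_eq)
  \<comment> \<open>The summands of \<open>(u \<otimes> t\<^sup>m)\<^sub>l (v \<otimes> t\<^sup>n)\<close> are again homogeneous.\<close>
  have summand: "loop_term sV Y l m u n v j \<in> va_carrier Lg"
    "mode_map YW (\<phi> (loop_term sV Y l m u n v j)) w = iterate_term sW Y pullback u v w l m n j" for j
  proof -
    have c: "in_coset M ((r + t) mod M) (m + n - of_nat j)"
      using in_coset_add[OF G.M_pos m, of t "n - of_nat j"] n in_coset_add_int[of "- of_nat j" M t n]
      by (simp add: add_diff_eq)
    have s: "(r + t) mod M < M" using G.M_pos by simp
    note e = eigenspace_product[OF u(2) v(2), of "l + int j"]
    show "loop_term sV Y l m u n v j \<in> va_carrier Lg"
      unfolding loop_term_def by (rule carrier_single[OF s c eigenspace_scale[OF e]])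
    show "mode_map YW (\<phi> (loop_term sV Y l m u n v j)) w = iterate_term sW Y pullback u v w l m n j"
      unfolding loop_term_def iterate_term_def mode_map_hom_scale[OF s c e]
      by (simp add: pullback_homogeneous[OF s e] c)
  qed
  have "va_product Lh l x y = \<phi> (Sum_any (loop_term sV Y l m u n v))"
    using hom_product[OF in_L, of l] VA.loop_product_single_single[of l m u n v]
    by (simp add: x_def y_def twisted_loop_def)
  then have "\<forall>\<^sub>F N in sequentially. mode_map YW (va_product Lh l x y) w
      = (\<Sum>j<N. iterate_term sW Y pullback u v w l m n j)"
    using VA.loop_term_sum_eventually[of l m u n v]
    by (auto elim!: eventually_mono simp: hom_sum summand(1) mode_map_eq_shifted_modes F.shifted_modes_sum
        simp flip: summand(2))
  then show ?thesis
    using loop_borcherds[OF in_L[THEN hom_closed], of l w]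
    unfolding borcherds_identity_def product_term_def shift x_def[symmetric] y_def[symmetric]
    by eventually_elim simp
next
  case n: False
  have "\<not> in_coset M t (n + i)" if "i \<in> \<int>" for i
    using n in_coset_add_int[OF that] by simp
  then have v0: "pullback v (n + i) = (\<lambda>_. 0)" if "i \<in> \<int>" for i
    using that by (simp add: pullback_homogeneous[OF v])
  have "product_term sW pullback u v w l m n j = 0" "product_term sW pullback v u w l n m j = 0" for j
    using v0[of "of_nat j"] v0[of "of_int l - of_nat j"] by (simp_all add: product_term_def add_diff_eq)
  moreover have "iterate_term sW Y pullback u v w l m n j = 0" for j
  proof -
    have "\<not> in_coset M ((r + t) mod M) (m + n - of_nat j)"
      using in_coset_add[OF G.M_pos m, of t "n - of_nat j"] n in_coset_add_int[of "- of_nat j" M t n]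
      by (simp add: add_diff_eq)
    then show ?thesis
      using G.M_pos by (simp add: iterate_term_def pullback_homogeneous[OF _ eigenspace_product[OF u(2) v(2)]])
  qed
  ultimately show ?thesis by (simp add: borcherds_identity_def)
qed

lemma borcherds_pullback:
  assumes u: "r < M" "u \<in> eigenspace sV \<zeta> g r" and m: "in_coset M r m"
  shows "borcherds_identity sW Y pullback u v w l m n"
proof (induction v rule: G.eigenspace_induct)
  case (1 t v)
  then show ?case by (intro borcherds_pullback_homogeneous[OF u _ _ m])
next
  case 2
  show ?case by (simp add: borcherds_identity_def product_term_def iterate_term_def)
next
  case (3 v v')
  then show ?case by (rule VA.borcherds_identity_add[OF P.field_map_axioms])
qed

lemma weak_twisted_module_pullback: "weak_twisted_module sV vac Y M \<zeta> g sW pullback"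
proof -
  have "twisted_jacobi sW Y pullback (of_nat r / of_nat M) u v w"
    if u: "r < M" "u \<in> eigenspace sV \<zeta> g r" for r u v w
  proof -
    have "pullback u n = (\<lambda>_. 0)" if "n - of_nat r / of_nat M \<notin> \<int>" for n
      using that by (simp add: pullback_homogeneous[OF u] in_coset_def)
    then show ?thesis
      using twisted_jacobi_iff_borcherds_identity[of sW "of_nat r / of_nat M" pullback u v w Y]
        F.W.vector_space_axioms truncation_pullback VA.regularity[of u v] borcherds_pullback[OF u]
      by (simp add: in_coset_def)
  qed
  then show ?thesis
    unfolding weak_twisted_module_def
    by (intro conjI allI impI ballI P.linear_field_map F.W.vector_space_axioms pullback_vacuum
        truncation_pullback) (auto simp: pullback_outside_coset)
qed

end

theorem proposition5p4:
  fixes sV :: "'k::{alg_closed_field, field_char_0} \<Rightarrow> 'v::ab_group_add \<Rightarrow> 'v"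
    and vac :: 'v
    and Y :: "'v \<Rightarrow> int \<Rightarrow> 'v \<Rightarrow> 'v"
    and g h :: "'v \<Rightarrow> 'v"
    and M :: nat
    and \<zeta> :: 'k
    and \<phi> :: "(rat \<Rightarrow>\<^sub>0 'v) \<Rightarrow> (rat \<Rightarrow>\<^sub>0 'v)"
    and sW :: "'k \<Rightarrow> 'w::ab_group_add \<Rightarrow> 'w"
    and YW :: "'v \<Rightarrow> rat \<Rightarrow> 'w \<Rightarrow> 'w"
  assumes "vertex_algebra sV vac Y"
    and "va_automorphism sV vac Y g" and "va_automorphism sV vac Y h"
    and "M \<ge> 1" and "g ^^ M = id" and "h ^^ M = id"
    and "primitive_root_of_unity M \<zeta>"
    and "R_vertex_algebra_hom (twisted_loop sV vac Y M \<zeta> g) (twisted_loop sV vac Y M \<zeta> h) \<phi>"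
    and "weak_twisted_module sV vac Y M \<zeta> h sW YW"
  shows "(\<exists>!Y'. is_pullback sV M \<zeta> g sW \<phi> YW Y') \<and>
    (\<forall>Y'. is_pullback sV M \<zeta> g sW \<phi> YW Y' \<longrightarrow> weak_twisted_module sV vac Y M \<zeta> g sW Y')"
proof -
  have "finite_order_operator sV g M \<zeta>"
    using assms(2,4,5,7) vertex_algebra.axioms(1)[OF assms(1)]
    by (simp add: finite_order_operator_def finite_order_operator_axioms_def va_automorphism_def)
  then interpret loop_homomorphism sV vac Y h M \<zeta> sW YW g \<phi>
    using assms(1,2,8,9)
    by (simp add: loop_homomorphism_def loop_homomorphism_axioms_def
        twisted_module_def twisted_module_axioms_def)
  show ?thesis
    using is_pullback_pullback pullback_unique weak_twisted_module_pullback by blast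
qed

end
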